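(* Let $Y$ be an $n$-dimensional (Gorenstein) Fano toric variety, let $\{D_1,\dots,D_c\}$ be a Calabi--Yau nef sub-partition on $Y$, and let $\mathcal V=\mathcal O_Y(D_1)\oplus\cdots\oplus\mathcal O_Y(D_c)$. Let $X=\mathrm{Tot}(\mathcal V^\vee)$ be the total space of the dual, and let $W_{BB}:X\to\mathbb C$ be the superpotential defined by the section $$\mathrm w_{BB}=\sum_{j}\ \sum_{0\neq\sigma\in P_{D_j}\cap M_Y}\exp(-2\pi)\,\sigma\ \in\Gamma(Y,\mathcal V).$$ For arbitrary $K\in A_{n-1}(Y)_{\mathbb C/\mathbb Z}$ (regarded as a class on $X$ by pullback), the Landau--Ginzburg model $(X',W',K')$ dual to $(X,W_{BB},K)$ has $X'=\mathrm{Tot}((\mathcal V^* )^\vee)$, and $W'$ comes from a global section of $\mathcal V^*$, where $\mathcal V^*$ is the Batyrev--Borisov mirror bundle over the toric variety $Y^*$ defined in the context.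
   Context: **Notation.** For an abelian group $G$ and a lattice $M$, $M_G=M\otimes_{\mathbb Z}G$. A toric variety $X$ of dimension $n$ with torus $T$ has character lattice $M_X$, dual lattice $N_X=\mathrm{Hom}(M_X,\mathbb Z)$, set $R_X$ of $T$-invariant prime divisors, character-to-divisor map $\mathrm{div}_X:M_X\to\mathbb Z^{R_X}$, Chow group $A_{n-1}(X)=\mathrm{coker}(\mathrm{div}_X)$, and $-\kappa_X=\sum_{\rho\in R_X}\rho$. For a $T$-invariant divisor $D$ on $Y$, $P_D=\{m\in(M_Y)_{\mathbb R}:\mathrm{div}_Y(m)+D\ge0\}$; lattice points of $P_D$ are identified with a basis of global (monomial) sections of $\mathcal O_Y(D)$. Put $P_D^\times=P_D\setminus\{0\}$. The polar of $C$ is $C^\circ=\{\xi: \nu(\xi)+1\ge0\ \forall\nu\in C\}$ (in the dual space). A lattice polytope $P$ with $0$ in its interior is reflexive if $P^\circ$ is a lattice polytope. The Gorenstein Fano toric variety $Y$ is the one defined by the inward normal fan $\Sigma_P$ of the reflexive polytope $P=P_{-\kappa_Y}\subset (M_Y)_{\mathbb R}$; the vertices of $P^\circ\subset (N_Y)_{\mathbb R}$ are the primitive generators of the rays of $\Sigma_P$. **Calabi--Yau nef sub-partition.** A collection $\{D_1,\dots,D_c\}\subset\mathbb Z^{R_Y}$ such that $D_j>0$ for all $j$, $-\kappa_Y-\sum_jD_j\ge0$, $[-\kappa_Y]=[\sum_jD_j]$ in $A_{n-1}(Y)$, and, writing $C_j=\mathrm{conv}(P^\times_{D_j}\cap M_Y)$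 and $C=\mathrm{conv}(\bigcup_j(P^\times_{D_j}\cap M_Y))$, one has $C_j\ne\varnothing$ for all $j$ and $\mathrm{vert}(C)=\bigcup_j\mathrm{vert}(C_j)$. **Nef partition and the mirror bundle.** Let $\mathbb E_j$ be the set of primitive generators of the rays corresponding to the prime divisors occurring in $D_j$. Then $\{\mathbb E_1,\dots,\mathbb E_c\}$ is a nef partition of $\mathrm{vert}(P^\circ)$: a partition for which there are integral convex $\Sigma_P$-piecewise linear functions $\phi_1,\dots,\phi_c$ on $(N_Y)_{\mathbb R}$ with $\phi_i(e)=\delta_{ij}$ for $e\in\mathbb E_j$. Put $\nabla_j=\{\mu\in(M_Y)_{\mathbb R}:\nu(\mu)\ge-\phi_j(\nu)\ \forall\nu\in(N_Y)_{\mathbb R}\}$, $(P^* )^\circ=\mathrm{conv}(\nabla_1\cup\cdots\cup\nabla_c)$ (a reflexive polytope), $P^*=((P^* )^\circ)^\circ\subset(N_Y)_{\mathbb R}$, $\nabla_j^\times=\mathrm{conv}(\nabla_j\setminus\{0\})$, and $\mathbb E_j^*=\mathrm{vert}(\nabla_j^\times)$; then $\{\mathbb E^*_1,\dots,\mathbb E^*_c\}$ is a nef partition of $\mathrm{vert}((P^* )^\circ)$ (the dual nef partition). Let $Y^*$ be the toric variety of the inward normal fan of $P^*$, let $D_j^*$ be the sum of the torus-invariant prime divisors of $Y^*$ whose primitive ray generators lie in $\mathbb E^*_j$, and $\mathcal V^*=\mathcal O_{Y^*}(D_1^* )\oplus\cdots\oplus\mathcal O_{Y^*}(D_c^* )$.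 **Toric variety from linear data.** Given $A:M\to\mathbb Z^s$ and $a\in\mathrm{coker}(A)_{\mathbb R}$, choose a lift $\alpha\in\mathbb R^s$ and put $P_\alpha=\{\xi\in M_{\mathbb R}:A(\xi)+\alpha\ge0\}$. If $P_\alpha$ has non-empty interior, $X(A,a)$ is the toric variety of the inward normal fan of $P_\alpha$ (independent of the lift). **Linear data of a function.** If $W=\sum_{\xi\in\Xi}q_\xi\xi$ on the torus ($q_\xi\neq0$), then $\mathrm{mon}_W:N_X\to\mathbb Z^\Xi$ is $\nu\mapsto(\nu(\xi))_\xi$, and $L\in\mathrm{coker}(\mathrm{mon}_W)_{\mathbb C/\mathbb Z}$ is the class of $(\frac1{2\pi i}\log q_\xi)_\xi$. For $B:N\to\mathbb Z^s$ with components $B_j\in\mathrm{Hom}(N,\mathbb Z)$ and $L\in\mathrm{coker}(B)_{\mathbb C/\mathbb Z}$ with lift $\lambda\in\mathbb C^s$, $W(B,L)=\sum_j\exp(2\pi i\lambda_j)B_j$, determined up to the torus action. **Dual model.** A toric Landau--Ginzburg model $(X,W,K)$ is a toric variety, a regular function, and a class $K\in A_{\dim X-1}(X)_{\mathbb C/\mathbb Z}$. Its dual is $(X',W',K')$ with $X'=X(\mathrm{mon}_W,\Im L)$ (so $M_{X'}=N_X$), $W'=W(\mathrm{div}_X,K)$, and $K'$ the class induced by $L$ under the map deleting redundant inequalities; $\Im$ is the imaginary part. **Functions from sections.** A global section of a bundle $\mathcal V$ defines a function on $\mathrm{Tot}(\mathcal V^\vee)$ by pairing $\mathcal V$ with $\mathcal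 V^\vee$; a function on $\mathrm{Tot}(\mathcal V^\vee)$ comes from a global section of $\mathcal V$ if it arises this way.
   Formalization: Each summand of w_BB also contains the monomial 0 of P_{D_j} with coefficient 1 (without it X' is affine and the claim fails), and {E_1,…,E_c} is assumed to be a nef partition with functions φ_j, which the listed conditions do not imply. *)

theory Defs
  imports "HOL-Analysis.Analysis"
begin

section \<open>Lattices and polytopes\<close>

text \<open>A lattice is the set of integral points of a Euclidean space with its standard basis. The
  standard lattice is self-dual, so M and N live in the same type and the pairing of M with N is the
  inner product.\<close>

definition lattice_pts :: "'a::euclidean_space set" where
  "lattice_pts = {x. \<forall>b\<in>Basis. x \<bullet> b \<in> \<int>}"

definition primitive :: "'a::euclidean_space \<Rightarrow> bool" where
  "primitive u \<longleftrightarrow> u \<in> lattice_pts \<and> u \<noteq> 0 \<and>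
     (\<forall>r. 0 < r \<and> r < 1 \<longrightarrow> r *\<^sub>R u \<notin> lattice_pts)"

definition lattice_polytope :: "'a::euclidean_space set \<Rightarrow> bool" where
  "lattice_polytope P \<longleftrightarrow> (\<exists>V. finite V \<and> V \<subseteq> lattice_pts \<and> P = convex hull V)"

definition polar :: "'a::euclidean_space set \<Rightarrow> 'a set" where
  "polar C = {\<xi>. \<forall>\<nu>\<in>C. \<nu> \<bullet> \<xi> + 1 \<ge> 0}"

definition reflexive :: "'a::euclidean_space set \<Rightarrow> bool" where
  "reflexive P \<longleftrightarrow> lattice_polytope P \<and> 0 \<in> interior P \<and> lattice_polytope (polar P)"

definition verts :: "'a::euclidean_space set \<Rightarrow> 'a set" where
  "verts S = {x. x extreme_point_of S}"


section \<open>Toric varieties, divisors and classes\<close>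

text \<open>A toric variety with its torus is represented by its fan, a set of cones in N; two toric
  varieties with the same lattice N are the same iff their fans are.\<close>

type_synonym 'a fan = "'a set set"

definition normal_cone :: "'a::euclidean_space set \<Rightarrow> 'a set \<Rightarrow> 'a set" where
  "normal_cone P F = {u. \<forall>x\<in>F. \<forall>y\<in>P. u \<bullet> x \<le> u \<bullet> y}"

definition normal_fan :: "'a::euclidean_space set \<Rightarrow> 'a fan" where
  "normal_fan P = {normal_cone P F | F. F face_of P \<and> F \<noteq> {}}"

text \<open>The torus-invariant prime divisors correspond to the one-dimensional cones, and these to their
  primitive generators. An element of a power of the integers (or of the complex numbers) indexed by
  the invariant prime divisors is a function of which only the values on these generators matter.\<close>

definition rays :: "'a::euclidean_space fan \<Rightarrow> 'a set" where
  "rays \<Sigma> = {u. primitive u \<and> {r *\<^sub>R u | r. 0 \<le> r} \<in> \<Sigma>}"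

definition div_polytope :: "'a::euclidean_space fan \<Rightarrow> ('a \<Rightarrow> int) \<Rightarrow> 'a set" where
  "div_polytope \<Sigma> D = {m. \<forall>u\<in>rays \<Sigma>. m \<bullet> u + of_int (D u) \<ge> 0}"

definition anticanonical :: "'a::euclidean_space \<Rightarrow> int" where
  "anticanonical = (\<lambda>u. 1)"

text \<open>Equality of the classes of two divisors in the cokernel of div.\<close>

definition lin_equiv :: "'a::euclidean_space fan \<Rightarrow> ('a \<Rightarrow> int) \<Rightarrow> ('a \<Rightarrow> int) \<Rightarrow> bool" where
  "lin_equiv \<Sigma> D D' \<longleftrightarrow>
     (\<exists>m\<in>lattice_pts. \<forall>u\<in>rays \<Sigma>. of_int (D u) - of_int (D' u) = m \<bullet> u)"

text \<open>Integral linear data are given by an index set I and rows A s, standing for the map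
  sending x to the family of all A s \<open>\<bullet>\<close> x with s in I. By right exactness the cokernel
  tensored with C/Z is the quotient of the I-indexed complex families by the integral families and by
  the image of the complexified lattice, whose elements are written x + i y. A class is represented
  as the set of its complex lifts.\<close>

definition coker_CZ :: "'i set \<Rightarrow> ('i \<Rightarrow> 'a::euclidean_space) \<Rightarrow> ('i \<Rightarrow> complex) \<Rightarrow> ('i \<Rightarrow> complex) set"
  where
  "coker_CZ I A l =
     {l'. \<exists>x y. \<forall>s\<in>I. l' s - l s - Complex (A s \<bullet> x) (A s \<bullet> y) \<in> \<int>}"

abbreviation chow_CZ_class :: "'a::euclidean_space fan \<Rightarrow> ('a \<Rightarrow> complex) \<Rightarrow> ('a \<Rightarrow> complex) set" where
  "chow_CZ_class \<Sigma> \<equiv> coker_CZ (rays \<Sigma>) (\<lambda>u. u)"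

definition chow_CZ :: "'a::euclidean_space fan \<Rightarrow> ('a \<Rightarrow> complex) set set" where
  "chow_CZ \<Sigma> = range (chow_CZ_class \<Sigma>)"


section \<open>Calabi--Yau nef sub-partitions and nef partitions\<close>

definition cy_nef_sub_partition ::
  "'a::euclidean_space fan \<Rightarrow> ('c::finite \<Rightarrow> 'a \<Rightarrow> int) \<Rightarrow> bool" where
  "cy_nef_sub_partition \<Sigma> D \<longleftrightarrow>
     (\<forall>j. (\<forall>u\<in>rays \<Sigma>. D j u \<ge> 0) \<and> (\<exists>u\<in>rays \<Sigma>. D j u \<noteq> 0)) \<and>
     (\<forall>u\<in>rays \<Sigma>. anticanonical u - (\<Sum>j\<in>UNIV. D j u) \<ge> 0) \<and>
     lin_equiv \<Sigma> anticanonical (\<lambda>u. \<Sum>j\<in>UNIV. D j u) \<and>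
     (let S = (\<lambda>j. (div_polytope \<Sigma> (D j) - {0}) \<inter> lattice_pts) in
        (\<forall>j. convex hull (S j) \<noteq> {}) \<and>
        verts (convex hull (\<Union>j. S j)) = (\<Union>j. verts (convex hull (S j))))"

definition integral_PL :: "'a::euclidean_space fan \<Rightarrow> ('a \<Rightarrow> real) \<Rightarrow> bool" where
  "integral_PL \<Sigma> \<phi> \<longleftrightarrow> (\<forall>\<sigma>\<in>\<Sigma>. \<exists>m\<in>lattice_pts. \<forall>u\<in>\<sigma>. \<phi> u = m \<bullet> u)"

definition nef_partition ::
  "'a::euclidean_space set \<Rightarrow> ('c \<Rightarrow> 'a set) \<Rightarrow> ('c \<Rightarrow> 'a \<Rightarrow> real) \<Rightarrow> bool" where
  "nef_partition P E \<phi> \<longleftrightarrow>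
     (\<Union>j. E j) = verts (polar P) \<and> disjoint_family E \<and> (\<forall>j. E j \<noteq> {}) \<and>
     (\<forall>i. integral_PL (normal_fan P) (\<phi> i) \<and> convex_on UNIV (\<phi> i)) \<and>
     (\<forall>i j. \<forall>e\<in>E j. \<phi> i e = (if i = j then 1 else 0))"

definition divisor_gens :: "'a::euclidean_space fan \<Rightarrow> ('a \<Rightarrow> int) \<Rightarrow> 'a set" where
  "divisor_gens \<Sigma> D = {u \<in> rays \<Sigma>. D u \<noteq> 0}"

definition nabla :: "('a::euclidean_space \<Rightarrow> real) \<Rightarrow> 'a set" where
  "nabla \<phi> = {\<mu>. \<forall>\<nu>. \<nu> \<bullet> \<mu> \<ge> - \<phi> \<nu>}"

definition mirror_polytope :: "('c \<Rightarrow> 'a::euclidean_space \<Rightarrow> real) \<Rightarrow> 'a set" where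
  "mirror_polytope \<phi> = polar (convex hull (\<Union>j. nabla (\<phi> j)))"

definition mirror_fan :: "('c \<Rightarrow> 'a::euclidean_space \<Rightarrow> real) \<Rightarrow> 'a fan" where
  "mirror_fan \<phi> = normal_fan (mirror_polytope \<phi>)"

definition mirror_divisor :: "('c \<Rightarrow> 'a::euclidean_space \<Rightarrow> real) \<Rightarrow> 'c \<Rightarrow> 'a \<Rightarrow> int" where
  "mirror_divisor \<phi> j u = (if u \<in> verts (convex hull (nabla (\<phi> j) - {0})) then 1 else 0)"


section \<open>Total spaces of split bundles and functions from sections\<close>

text \<open>The total space of the dual of the sum of the line bundles O(D j). Over the affine chart of a
  cone \<open>\<sigma>\<close>, the Cartier divisor D j has local data m j in M, that is, m j \<open>\<bullet>\<close> u = D j u for the ray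
  generators u in \<open>\<sigma>\<close>, and the monomial with exponent - m j trivialises O(D j). Paired with the dual
  bundle it is the j-th fibre coordinate, a monomial with exponent (- m j, e j). The part of the
  total space over this chart is therefore the affine toric variety of the cone of all (u, t) with u
  in \<open>\<sigma>\<close> and t j \<open>\<ge>\<close> m j \<open>\<bullet>\<close> u for all j. Turning some of these inequalities into equalities (those with j
  not in J) removes the corresponding zero loci; together with the faces of \<open>\<sigma>\<close> this produces all the
  faces.\<close>

definition tot_dual_fan ::
  "'a::euclidean_space fan \<Rightarrow> ('c::finite \<Rightarrow> 'a \<Rightarrow> int) \<Rightarrow> ('a \<times> (real ^ 'c)) fan" where
  "tot_dual_fan \<Sigma> D =
     {{(u, t). u \<in> \<sigma> \<and> (\<forall>j\<in>J. t $ j \<ge> m j \<bullet> u) \<and> (\<forall>j\<in>-J. t $ j = m j \<bullet> u)} | \<sigma> J m.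
        \<sigma> \<in> \<Sigma> \<and> (\<forall>j. m j \<in> lattice_pts \<and> (\<forall>u\<in>rays \<Sigma> \<inter> \<sigma>. m j \<bullet> u = of_int (D j u)))}"

text \<open>A regular function on a toric variety, or a global section of O(D), is represented by the
  coefficients of its Laurent expansion, a finitely supported function on M.\<close>

definition global_section ::
  "'a::euclidean_space fan \<Rightarrow> ('c \<Rightarrow> 'a \<Rightarrow> int) \<Rightarrow> ('c \<Rightarrow> 'a \<Rightarrow> complex) \<Rightarrow> bool" where
  "global_section \<Sigma> D s \<longleftrightarrow>
     (\<forall>j. finite {m. s j m \<noteq> 0} \<and> {m. s j m \<noteq> 0} \<subseteq> div_polytope \<Sigma> (D j) \<inter> lattice_pts)"

text \<open>Over the torus of the base both bundles are trivial, and the section s pairs with the point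
  (y, t) to the sum over j of t j times s j y. So the monomial m of s j contributes the monomial
  (m, e j).\<close>

definition section_fun :: "('c::finite \<Rightarrow> 'a \<Rightarrow> complex) \<Rightarrow> 'a \<times> (real ^ 'c) \<Rightarrow> complex" where
  "section_fun s = (\<lambda>(m, t). \<Sum>j\<in>UNIV. if t = axis j 1 then s j m else 0)"

text \<open>Pullback of classes along the projection from the total space: the prime divisor of the ray u of
  the base pulls back to the prime divisor of the unique ray of the total space over u, and the rays
  (0, e j) do not lie over a ray of the base.\<close>

definition chow_pullback ::
  "'a::euclidean_space fan \<Rightarrow> ('c::finite \<Rightarrow> 'a \<Rightarrow> int) \<Rightarrow> ('a \<Rightarrow> complex) set \<Rightarrow>
   ('a \<times> (real ^ 'c) \<Rightarrow> complex) set" where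
  "chow_pullback \<Sigma> D K =
     (\<Union>k\<in>K. chow_CZ_class (tot_dual_fan \<Sigma> D) (\<lambda>(u, t). if u = 0 then 0 else k u))"

text \<open>The monomial 0 of each summand carries the coefficient 1, all other monomials carry exp(-2 pi).
  If the monomials 0 were left out (or given the coefficient exp(-2 pi) as well), the inequalities of
  the dual model would all have the same constant term, and the dual would be the affine toric variety
  of a cone instead of a total space over a complete base.\<close>

definition w_BB ::
  "'a::euclidean_space fan \<Rightarrow> ('c \<Rightarrow> 'a \<Rightarrow> int) \<Rightarrow> 'c \<Rightarrow> 'a \<Rightarrow> complex" where
  "w_BB \<Sigma> D j \<sigma> =
     (if \<sigma> \<in> div_polytope \<Sigma> (D j) \<inter> lattice_pts
      then (if \<sigma> = 0 then 1 else of_real (exp (- 2 * pi))) else 0)"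


section \<open>Linear data and the dual model\<close>

definition data_polyhedron ::
  "'i set \<Rightarrow> ('i \<Rightarrow> 'a::euclidean_space) \<Rightarrow> ('i \<Rightarrow> real) \<Rightarrow> 'a set" where
  "data_polyhedron I A \<alpha> = {\<xi>. \<forall>s\<in>I. A s \<bullet> \<xi> + \<alpha> s \<ge> 0}"

definition monomials :: "('a \<Rightarrow> complex) \<Rightarrow> 'a set" where
  "monomials W = {\<xi>. W \<xi> \<noteq> 0}"

definition log_class :: "('a::euclidean_space \<Rightarrow> complex) \<Rightarrow> ('a \<Rightarrow> complex) set" where
  "log_class W = coker_CZ (monomials W) (\<lambda>\<xi>. \<xi>) (\<lambda>\<xi>. Ln (W \<xi>) / (2 * of_real pi * \<i>))"

definition fun_of_data ::
  "'i set \<Rightarrow> ('i \<Rightarrow> 'a::euclidean_space) \<Rightarrow> ('i \<Rightarrow> complex) \<Rightarrow> 'a \<Rightarrow> complex" where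
  "fun_of_data I B l = (\<lambda>b. \<Sum>s\<in>{s\<in>I. B s = b}. exp (2 * of_real pi * \<i> * l s))"

text \<open>The dual of (X, W, K) is determined up to the choice of lifts l of L and k of K; the latter
  changes W' by the action of the torus. Among the inequalities of the polyhedron, the irredundant
  ones are those which are indexed by the generators of the rays of X' and attained. The restriction
  of l to them is a lift of K'.\<close>

definition dual_LG ::
  "'a::euclidean_space fan \<Rightarrow> ('a \<Rightarrow> complex) \<Rightarrow> ('a \<Rightarrow> complex) set \<Rightarrow>
   'a fan \<Rightarrow> ('a \<Rightarrow> complex) \<Rightarrow> ('a \<Rightarrow> complex) set \<Rightarrow> bool" where
  "dual_LG X W K X' W' K' \<longleftrightarrow>
     (\<exists>l\<in>log_class W.
        let P = data_polyhedron (monomials W) (\<lambda>\<xi>. \<xi>) (\<lambda>\<xi>. Im (l \<xi>)) in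
          interior P \<noteq> {} \<and> X' = normal_fan P \<and>
          (\<forall>u\<in>rays X'. u \<in> monomials W \<and> (\<exists>x\<in>P. u \<bullet> x + Im (l u) = 0)) \<and>
          K' = chow_CZ_class X' l) \<and>
     (\<exists>k\<in>K. W' = fun_of_data (rays X) (\<lambda>u. u) k)"

end

theory Submission
  imports Defs
begin

text \<open>Write \<open>B j\<close> for the convex hull of 0 and \<open>E j\<close>. The mirror polytope is the Minkowski sum of the
  \<open>B j\<close>, and up to translation the polyhedron of the dual model consists of the points
  \<open>(\<Sum>j. (1 + t j) b j, t)\<close> with \<open>t j \<ge> 0\<close> and \<open>b j \<in> B j\<close>. A linear form \<open>(u, \<tau>)\<close> is minimal at such a
  point iff \<open>u\<close> is minimal on the mirror polytope at \<open>\<Sum>j. b j\<close> and \<open>\<tau> j \<ge> - u \<bullet> b j\<close>, with equality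
  where \<open>t j > 0\<close>. Since \<open>u \<mapsto> - u \<bullet> b j\<close> is the local data of the j-th mirror divisor on the normal
  cone at \<open>\<Sum>j. b j\<close>, these are exactly the cones of the total space over the mirror variety. The
  dual superpotential is supported on the rays \<open>(u, e j)\<close> of the original total space, with
  \<open>u = 0\<close> or \<open>u \<in> E j\<close>, and each such \<open>u\<close> lies in the polytope of the j-th mirror divisor.\<close>

section \<open>Polar bodies and normal fans\<close>

lemma lattice_zero [simp]: "0 \<in> lattice_pts"
  by (simp add: lattice_pts_def)

lemma lattice_uminus: "x \<in> lattice_pts \<Longrightarrow> - x \<in> lattice_pts"
  by (simp add: lattice_pts_def)

lemma lattice_inner:
  assumes "x \<in> lattice_pts" "y \<in> lattice_pts"
  shows "x \<bullet> y \<in> \<int>"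
  using assms unfolding euclidean_inner[of x y] lattice_pts_def by (intro Ints_sum Ints_mult) auto

lemma lattice_sum: "(\<And>i. i \<in> I \<Longrightarrow> f i \<in> lattice_pts) \<Longrightarrow> sum f I \<in> lattice_pts"
  unfolding lattice_pts_def by (auto simp: inner_sum_left intro!: Ints_sum)

section \<open>Polar bodies\<close>

lemma polarD: "w \<in> polar C \<Longrightarrow> x \<in> C \<Longrightarrow> w \<bullet> x \<ge> -1"
  unfolding polar_def by (force simp: inner_commute)

lemma polar_eq_Inter: "polar C = (\<Inter>\<nu>\<in>C. {\<xi>. \<nu> \<bullet> \<xi> \<ge> -1})"
  unfolding polar_def by force

lemma closed_polar: "closed (polar C)"
  unfolding polar_eq_Inter by (intro closed_INT ballI closed_halfspace_ge)

lemma convex_polar: "convex (polar C)"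
  unfolding polar_eq_Inter by (intro convex_INT ballI convex_halfspace_ge)

lemma zero_in_polar: "0 \<in> polar C"
  by (simp add: polar_def)

lemma polar_convex_hull: "polar (convex hull C) = polar C"
proof
  show "polar (convex hull C) \<subseteq> polar C"
    unfolding polar_def using hull_subset[of C convex] by blast
  show "polar C \<subseteq> polar (convex hull C)"
  proof
    fix \<xi> assume "\<xi> \<in> polar C"
    then have "C \<subseteq> {\<nu>. \<xi> \<bullet> \<nu> \<ge> -1}"
      unfolding polar_def by (force simp: inner_commute)
    then have "convex hull C \<subseteq> {\<nu>. \<xi> \<bullet> \<nu> \<ge> -1}"
      by (simp add: convex_halfspace_ge subset_hull)
    then show "\<xi> \<in> polar (convex hull C)"
      unfolding polar_def by (force simp: inner_commute)
  qed
qed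

text \<open>Bipolar theorem: a hyperplane strictly separating a point from \<open>C\<close> has a
  negative bound because 0 lies in \<open>C\<close>, so it can be rescaled to an element of the
  polar that excludes the point.\<close>

lemma polar_polar:
  fixes C :: "'a::euclidean_space set"
  assumes "closed C" "convex C" "0 \<in> C"
  shows "polar (polar C) = C"
proof
  show "C \<subseteq> polar (polar C)"
    by (auto simp: polar_def inner_commute)
  show "polar (polar C) \<subseteq> C"
  proof (rule ccontr)
    assume "\<not> polar (polar C) \<subseteq> C"
    then obtain z where z: "z \<in> polar (polar C)" "z \<notin> C" by blast
    obtain a b where ab: "a \<bullet> z < b" "\<forall>x\<in>C. a \<bullet> x > b"
      using separating_hyperplane_closed_point[of C z] assms z(2) by blast
    from ab(2) \<open>0 \<in> C\<close> have b: "b < 0" by force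
    \<comment> \<open>The separating normal is scaled so that its bound on \<open>C\<close> becomes
      -1.\<close>
    have "a /\<^sub>R (- b) \<in> polar C"
      unfolding polar_def
    proof clarify
      fix \<nu> assume "\<nu> \<in> C"
      then have "a \<bullet> \<nu> > b" using ab by blast
      then show "\<nu> \<bullet> (a /\<^sub>R (- b)) + 1 \<ge> 0"
        using b by (simp add: inner_commute field_simps)
    qed
    then have "(a /\<^sub>R (- b)) \<bullet> z + 1 \<ge> 0"
      using z(1) unfolding polar_def by blast
    then show False
      using ab(1) b by (simp add: field_simps)
  qed
qed

text \<open>By Cauchy-Schwarz the ball of radius 1/\<open>B\<close> lies in the polar, where
  \<open>B\<close> bounds the norms on \<open>C\<close>.\<close>

lemma zero_in_interior_polar:
  fixes C :: "'a::euclidean_space set"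
  assumes "bounded C"
  shows "0 \<in> interior (polar C)"
proof -
  obtain B where B: "B > 0" "\<And>x. x \<in> C \<Longrightarrow> norm x \<le> B"
    using assms bounded_pos by blast
  have "ball 0 (1 / B) \<subseteq> polar C"
    unfolding polar_def
  proof clarify
    fix \<xi> \<nu> :: 'a assume "\<xi> \<in> ball 0 (1 / B)" "\<nu> \<in> C"
    then have "norm \<xi> \<le> 1 / B" "norm \<nu> \<le> B" using B by auto
    then have "norm \<nu> * norm \<xi> \<le> B * (1 / B)"
      by (intro mult_mono) (use B in auto)
    then show "\<nu> \<bullet> \<xi> + 1 \<ge> 0"
      using Cauchy_Schwarz_ineq2[of \<nu> \<xi>] B by simp
  qed
  then show ?thesis
    using B(1) by (meson centre_in_ball interior_maximal open_ball subsetD zero_less_divide_1_iff)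
qed

lemma bounded_polar:
  fixes C :: "'a::euclidean_space set"
  assumes "0 \<in> interior C"
  shows "bounded (polar C)"
proof -
  obtain e where e: "e > 0" "cball 0 e \<subseteq> C"
    using assms mem_interior_cball by blast
  have "norm \<xi> \<le> 1 / e" if "\<xi> \<in> polar C" for \<xi>
  proof (cases "\<xi> = 0")
    case False
    \<comment> \<open>The point of norm \<open>e\<close> opposite to \<xi> gives the strongest
      inequality among the points of the ball.\<close>
    have "- (e / norm \<xi>) *\<^sub>R \<xi> \<in> C"
      using e False by (intro subsetD[OF e(2)]) simp
    then have "(- (e / norm \<xi>) *\<^sub>R \<xi>) \<bullet> \<xi> + 1 \<ge> 0"
      using that unfolding polar_def by blast
    then have "e * norm \<xi> \<le> 1"
      using False by (simp add: dot_square_norm power2_eq_square)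
    then show ?thesis
      using e by (simp add: field_simps)
  qed (use e in auto)
  then show ?thesis
    unfolding bounded_iff by blast
qed

section \<open>Vertices of polytopes\<close>

lemma lattice_polytopeD:
  assumes "lattice_polytope P"
  shows "polytope P" "compact P" "convex P" "verts P \<subseteq> lattice_pts" "finite (verts P)"
proof -
  obtain V where V: "finite V" "V \<subseteq> lattice_pts" "P = convex hull V"
    using assms lattice_polytope_def by blast
  show "polytope P" using V polytope_def by blast
  then show "compact P" "convex P"
    by (simp_all add: polytope_imp_compact polytope_imp_convex)
  have "verts P \<subseteq> V"
    using V(3) extreme_point_of_convex_hull verts_def by blast
  then show "verts P \<subseteq> lattice_pts" "finite (verts P)"
    using V finite_subset by blast+
qed

lemma hull_verts:
  fixes S :: "'a::euclidean_space set"
  shows "compact S \<Longrightarrow> convex S \<Longrightarrow> convex hull (verts S) = S"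
  using Krein_Milman_Minkowski[of S] unfolding verts_def by simp

text \<open>The minimisers of a linear form are a compact convex face; an extreme point of this face
  is extreme in \<open>S\<close>.\<close>

lemma minimum_at_vertex:
  fixes S :: "'a::euclidean_space set"
  assumes "compact S" "convex S" "S \<noteq> {}"
  obtains v where "v \<in> verts S" "u \<in> normal_cone S {v}"
proof -
  have "continuous_on S ((\<bullet>) u)"
    by (intro continuous_intros)
  then obtain m where m: "m \<in> S" "\<And>y. y \<in> S \<Longrightarrow> u \<bullet> m \<le> u \<bullet> y"
    using continuous_attains_inf[of S "\<lambda>x. u \<bullet> x"] assms by auto
  define T where "T = S \<inter> {x. u \<bullet> x = u \<bullet> m}"
  have T: "T face_of S"
    unfolding T_def using m by (intro face_of_Int_supporting_hyperplane_ge assms) auto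
  then obtain v where v: "v extreme_point_of T"
    using extreme_point_exists_convex[of T] face_of_imp_compact[OF assms(2,1) T]
      face_of_imp_convex[OF T] m(1) unfolding T_def by blast
  then have "v \<in> verts S" "v \<in> T"
    using extreme_point_of_face[OF T] by (auto simp: verts_def)
  then show ?thesis
    using m that[of v] unfolding T_def normal_cone_def by force
qed

lemma reflexive_facts:
  assumes "reflexive P"
  shows "polar (polar P) = P" "0 \<in> interior (polar P)" "0 \<in> P" "reflexive (polar P)"
proof -
  have P: "lattice_polytope P" "0 \<in> interior P" "lattice_polytope (polar P)"
    using assms unfolding reflexive_def by auto
  show "0 \<in> P" using P(2) interior_subset by blast
  then show eq: "polar (polar P) = P"
    using lattice_polytopeD[OF P(1)] by (simp add: compact_imp_closed polar_polar)
  show "0 \<in> interior (polar P)"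
    using lattice_polytopeD[OF P(1)] by (simp add: compact_imp_bounded zero_in_interior_polar)
  then show "reflexive (polar P)"
    unfolding reflexive_def using P eq by auto
qed

section \<open>Normal cones and the normal fan\<close>

text \<open>A face has the same normal cone as any point of its relative interior. Conversely, the
  cone at a point is the cone of the face on which all its forms are minimal. This allows cones to
  be indexed by points, without knowledge of the faces.\<close>

lemma normal_fan_pointwise:
  assumes "convex S"
  shows "normal_fan S = {normal_cone S {x} | x. x \<in> S}"
proof (intro equalityI subsetI)
  fix \<sigma> assume "\<sigma> \<in> normal_fan S"
  then obtain F where F: "F face_of S" "F \<noteq> {}" "\<sigma> = normal_cone S F"
    unfolding normal_fan_def by blast
  have "convex F" using F(1) face_of_imp_convex by blast
  then obtain x where x: "x \<in> rel_interior F"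
    using F(2) rel_interior_eq_empty by blast
  then have xF: "x \<in> F" using rel_interior_subset by blast
  have "normal_cone S F = normal_cone S {x}"
  proof
    show "normal_cone S F \<subseteq> normal_cone S {x}"
      using xF unfolding normal_cone_def by blast
    show "normal_cone S {x} \<subseteq> normal_cone S F"
      unfolding normal_cone_def
    proof clarsimp
      fix u z y assume u: "\<forall>y\<in>S. u \<bullet> x \<le> u \<bullet> y" and zy: "z \<in> F" "y \<in> S"
      \<comment> \<open>The segment from \<open>z\<close> to \<open>x\<close> can be prolonged
        beyond \<open>x\<close> inside \<open>F\<close>, so a form minimal at \<open>x\<close>
        cannot be larger at \<open>z\<close>.\<close>
      obtain e where e: "e > 1" "(1 - e) *\<^sub>R z + e *\<^sub>R x \<in> F"
        using convex_rel_interior_iff[OF \<open>convex F\<close> F(2)] x zy(1) by blast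
      then have "u \<bullet> x \<le> u \<bullet> ((1 - e) *\<^sub>R z + e *\<^sub>R x)"
        using u F(1) face_of_imp_subset by blast
      then have "(e - 1) * (u \<bullet> z) \<le> (e - 1) * (u \<bullet> x)"
        by (simp add: inner_add_right algebra_simps)
      then have "u \<bullet> z \<le> u \<bullet> x" using e by simp
      then show "u \<bullet> z \<le> u \<bullet> y" using u zy(2) order_trans by blast
    qed
  qed
  then show "\<sigma> \<in> {normal_cone S {x} | x. x \<in> S}"
    using F xF face_of_imp_subset by blast
next
  fix \<sigma> assume "\<sigma> \<in> {normal_cone S {x} | x. x \<in> S}"
  then obtain x where x: "x \<in> S" "\<sigma> = normal_cone S {x}" by blast
  define F where "F = S \<inter> (\<Inter>u\<in>normal_cone S {x}. S \<inter> {y. u \<bullet> y = u \<bullet> x})"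
  have "(\<Inter>u\<in>normal_cone S {x}. S \<inter> {y. u \<bullet> y = u \<bullet> x}) face_of S"
  proof (intro face_of_Inter)
    \<comment> \<open>The zero form keeps the family of faces non-empty, so that its intersection is
      a face.\<close>
    have "0 \<in> normal_cone S {x}" by (simp add: normal_cone_def)
    then show "(\<lambda>u. S \<inter> {y. u \<bullet> y = u \<bullet> x}) ` normal_cone S {x} \<noteq> {}" by blast
  next
    fix T assume "T \<in> (\<lambda>u. S \<inter> {y. u \<bullet> y = u \<bullet> x}) ` normal_cone S {x}"
    then show "T face_of S"
      using assms by (auto simp: normal_cone_def intro!: face_of_Int_supporting_hyperplane_ge)
  qed
  then have "F face_of S"
    unfolding F_def using assms by (intro face_of_Int face_of_refl)
  moreover have xF: "x \<in> F" unfolding F_def using x by auto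
  moreover have "normal_cone S F = normal_cone S {x}"
  proof
    show "normal_cone S F \<subseteq> normal_cone S {x}"
      using xF unfolding normal_cone_def by blast
    show "normal_cone S {x} \<subseteq> normal_cone S F"
    proof
      fix u assume u: "u \<in> normal_cone S {x}"
      then have "\<forall>z\<in>F. u \<bullet> z = u \<bullet> x" unfolding F_def by blast
      then show "u \<in> normal_cone S F" using u unfolding normal_cone_def by simp
    qed
  qed
  ultimately show "\<sigma> \<in> normal_fan S"
    unfolding normal_fan_def using x by blast
qed

text \<open>If \<open>u\<close> has minimum -\<open>h\<close> at \<open>v\<close> with
  \<open>h\<close> > 0, then \<open>u\<close> divided by \<open>h\<close> lies in the face of the
  polar on which \<open>v\<close> takes the value -1, and is a convex combination of vertices of
  that face. If \<open>h\<close> = 0, then \<open>u\<close> is nonnegative on a ball around 0 and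
  vanishes.\<close>

lemma normal_cone_spanned:
  fixes P :: "'a::euclidean_space set"
  assumes "0 \<in> interior P" and "u \<in> normal_cone P {v}" and "v \<in> P"
  obtains T c where "finite T" "T \<subseteq> verts (polar P)" "\<forall>e\<in>T. e \<bullet> v = -1"
    "\<forall>e\<in>T. e \<in> normal_cone P {v}"
    "\<forall>e\<in>T. c e \<ge> 0" "u = (\<Sum>e\<in>T. c e *\<^sub>R e)"
proof -
  define h where "h = - (u \<bullet> v)"
  have uy: "u \<bullet> y \<ge> - h" if "y \<in> P" for y
    using assms(2) that unfolding normal_cone_def h_def by auto
  have "u \<bullet> 0 \<ge> - h" using assms(1) interior_subset uy by blast
  then have "h \<ge> 0" by simp
  show ?thesis
  proof (cases "h = 0")
    case True
    obtain e where e: "e > 0" "cball 0 e \<subseteq> P"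
      using assms(1) mem_interior_cball by blast
    have "u = 0"
    proof (rule ccontr)
      assume "u \<noteq> 0"
      then have "- (e / norm u) *\<^sub>R u \<in> P"
        using e by (intro subsetD[OF e(2)]) simp
      then have "u \<bullet> (- (e / norm u) *\<^sub>R u) \<ge> 0" using uy True by force
      then show False using e \<open>u \<noteq> 0\<close> by (simp add: dot_square_norm power2_eq_square mult_le_0_iff)
    qed
    then show ?thesis using that[of "{}" "\<lambda>_. 0"] by simp
  next
    case False
    then have h: "h > 0" using \<open>h \<ge> 0\<close> by simp
    define G where "G = polar P \<inter> {w. v \<bullet> w = -1}"
    have "v \<bullet> w \<ge> -1" if "w \<in> polar P" for w
      using that assms(3) unfolding polar_def by force
    then have G: "G face_of polar P"
      unfolding G_def by (intro face_of_Int_supporting_hyperplane_ge convex_polar)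
    have "compact (polar P)"
      by (simp add: assms(1) bounded_polar closed_polar compact_eq_bounded_closed)
    then have "convex hull (verts G) = G"
      using face_of_imp_compact[OF convex_polar _ G] face_of_imp_convex[OF G] hull_verts by blast
    moreover have "u /\<^sub>R h \<in> G"
    proof -
      have "y \<bullet> (u /\<^sub>R h) + 1 \<ge> 0" if "y \<in> P" for y
        using uy[OF that] h by (simp add: inner_commute field_simps)
      moreover have "v \<bullet> (u /\<^sub>R h) = -1"
        using h unfolding h_def by (simp add: inner_commute field_simps)
      ultimately show ?thesis
        unfolding G_def polar_def by blast
    qed
    ultimately have "u /\<^sub>R h \<in> convex hull (verts G)" by simp
    then obtain T c where T: "finite T" "T \<subseteq> verts G" "\<And>e. e \<in> T \<Longrightarrow> 0 \<le> c e"
      "(\<Sum>e\<in>T. c e *\<^sub>R e) = u /\<^sub>R h"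
      unfolding convex_hull_explicit by blast
    have vG: "verts G \<subseteq> verts (polar P)" "verts G \<subseteq> G"
      unfolding verts_def using extreme_point_of_face[OF G] by auto
    have ev: "e \<bullet> v = -1" "e \<in> polar P" if "e \<in> T" for e
      using that T(2) vG unfolding G_def by (auto simp: inner_commute)
    then have "e \<in> normal_cone P {v}" if "e \<in> T" for e
      using that unfolding normal_cone_def polar_def by (force simp: inner_commute)
    moreover have "u = (\<Sum>e\<in>T. (h * c e) *\<^sub>R e)"
    proof -
      have "u = h *\<^sub>R (u /\<^sub>R h)" using h by simp
      also have "\<dots> = (\<Sum>e\<in>T. (h * c e) *\<^sub>R e)"
        unfolding T(4)[symmetric] by (simp add: scaleR_sum_right)
      finally show ?thesis .
    qed
    ultimately show ?thesis
      using that[of T "\<lambda>e. h * c e"] T vG ev h by force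
  qed
qed

text \<open>A vertex of a polyhedron is exposed, and the exposing functional, suitably rescaled, is
  a point of the bipolar \<open>P\<close>.\<close>

lemma extreme_dual_exposed:
  fixes P :: "'a::euclidean_space set"
  assumes "reflexive P" and "w \<in> verts (polar P)"
  obtains x where "x \<in> P" "w \<bullet> x = -1" "\<And>w'. w' \<in> polar P \<Longrightarrow> w' \<bullet> x = -1 \<Longrightarrow> w' = w"
    "w \<noteq> 0" "w \<in> polar P"
proof -
  have w: "w extreme_point_of polar P" using assms(2) verts_def by blast
  have "polyhedron (polar P)"
    using assms(1) lattice_polytopeD(1) polytope_imp_polyhedron reflexive_def by blast
  then have "{w} exposed_face_of polar P"
    using w exposed_face_of_polyhedron face_of_singleton by blast
  then obtain a b where ab: "polar P \<subseteq> {x. a \<bullet> x \<le> b}" "{w} = polar P \<inter> {x. a \<bullet> x = b}"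
    unfolding exposed_face_of_def by blast
  have w0: "w \<noteq> 0"
    using extreme_point_not_in_interior[OF w] reflexive_facts(2)[OF assms(1)] by blast
  have "b \<ge> 0" using ab(1) zero_in_polar[of P] by force
  moreover have "b \<noteq> 0" using ab(2) zero_in_polar[of P] w0 by force
  ultimately have b: "b > 0" by simp
  \<comment> \<open>The bound \<open>b\<close> is positive since 0 lies in the polar but is not the
    exposed vertex; the scaling turns the bound into -1.\<close>
  define x where "x = (- 1 / b) *\<^sub>R a"
  have dot: "w' \<bullet> x = - (a \<bullet> w') / b" for w'
    unfolding x_def by (simp add: inner_commute)
  have "x \<in> polar (polar P)"
    unfolding polar_def[of "polar P"] mem_Collect_eq dot using ab(1) b by (auto simp: field_simps)
  then have "x \<in> P" using reflexive_facts(1)[OF assms(1)] by simp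
  moreover have "w \<bullet> x = -1" "w \<in> polar P"
    using ab(2) b unfolding dot by auto
  moreover have "w' = w" if "w' \<in> polar P" "w' \<bullet> x = -1" for w'
    using that ab(2) b unfolding dot by (auto simp: field_simps)
  ultimately show ?thesis using that w0 by blast
qed

section \<open>Primitive vectors and ray generators\<close>

lemma primitive_multiple:
  assumes "primitive u" "primitive (r *\<^sub>R u)" "r \<ge> 0"
  shows "r = 1"
proof (rule ccontr)
  assume "r \<noteq> 1"
  have "r \<noteq> 0" using assms(2) unfolding primitive_def by auto
  then have r: "r > 0" using assms(3) by simp
  show False
  proof (cases "r < 1")
    case True
    then show ?thesis using assms r unfolding primitive_def by blast
  next
    case False
    then have "0 < 1 / r" "1 / r < 1" using r \<open>r \<noteq> 1\<close> by auto
    then have "(1 / r) *\<^sub>R (r *\<^sub>R u) \<notin> lattice_pts"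
      using assms(2) unfolding primitive_def by blast
    then show ?thesis using assms(1) r unfolding primitive_def by simp
  qed
qed

text \<open>If \<open>r\<close> times \<open>w\<close> is integral, then so is its pairing with
  \<open>v\<close>, which is -\<open>r\<close>.\<close>

lemma primitive_of_inner:
  assumes "w \<in> lattice_pts" "v \<in> lattice_pts" "w \<bullet> v = -1"
  shows "primitive w"
proof -
  have "r *\<^sub>R w \<notin> lattice_pts" if r: "0 < r" "r < 1" for r
  proof
    assume "r *\<^sub>R w \<in> lattice_pts"
    then have "(r *\<^sub>R w) \<bullet> v \<in> \<int>" using lattice_inner assms(2) by blast
    then have "r \<in> \<int>" using assms(3) by simp
    then show False using r by (auto elim!: Ints_cases)
  qed
  then show ?thesis using assms unfolding primitive_def by auto
qed

text \<open>The normal cone at a point that exposes a vertex \<open>w\<close> of the polar has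
  \<open>w\<close> as its only generator. Conversely, the generators of a one-dimensional cone are
  vertices of the polar, hence primitive, and coincide with the primitive generator of the
  ray.\<close>

lemma rays_normal_fan:
  fixes P :: "'a::euclidean_space set"
  assumes P: "reflexive P"
  shows "rays (normal_fan P) = verts (polar P)"
proof -
  have L: "lattice_polytope P" "0 \<in> interior P" "lattice_polytope (polar P)"
    using P unfolding reflexive_def by auto
  note P1 = lattice_polytopeD[OF L(1)]
  note P3 = lattice_polytopeD[OF L(3)]
  have prim: "primitive w" if w: "w \<in> verts (polar P)" for w
  proof -
    obtain x where x: "x \<in> P" "w \<bullet> x = -1" "w \<in> polar P"
      using extreme_dual_exposed[OF P w] by metis
    \<comment> \<open>The value -1 at \<open>x\<close> is the minimum of \<open>w\<close> on
      \<open>P\<close>, so it is also taken at a vertex, which is integral.\<close>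
    obtain v where v: "v \<in> verts P" "w \<in> normal_cone P {v}"
      using minimum_at_vertex[of P w] P1 x(1) by blast
    then have "v \<in> P" unfolding verts_def extreme_point_of_def by blast
    have "w \<bullet> v = -1"
      using v(2) x \<open>v \<in> P\<close> unfolding normal_cone_def polar_def by (force simp: inner_commute)
    then show ?thesis using primitive_of_inner w v P1 P3 by blast
  qed
  show ?thesis
  proof (intro equalityI subsetI)
    fix w assume w: "w \<in> verts (polar P)"
    obtain x where x: "x \<in> P" "w \<bullet> x = -1" "w \<in> polar P"
      "\<And>w'. w' \<in> polar P \<Longrightarrow> w' \<bullet> x = -1 \<Longrightarrow> w' = w"
      using extreme_dual_exposed[OF P w] by metis
    have "normal_cone P {x} = {r *\<^sub>R w | r. 0 \<le> r}"
    proof (intro equalityI subsetI)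
      fix u assume "u \<in> normal_cone P {x}"
      then obtain T c where T: "finite T" "T \<subseteq> verts (polar P)" "\<forall>e\<in>T. e \<bullet> x = -1"
        "\<forall>e\<in>T. e \<in> normal_cone P {x}"
        "\<forall>e\<in>T. c e \<ge> 0" "u = (\<Sum>e\<in>T. c e *\<^sub>R e)"
        by (rule normal_cone_spanned[OF L(2) _ x(1)])
      have "e = w" if "e \<in> T" for e
        using T(2,3) that x(4) unfolding verts_def extreme_point_of_def by blast
      then have "u = (\<Sum>e\<in>T. c e) *\<^sub>R w"
        unfolding T(6) scaleR_left.sum by (intro sum.cong) auto
      then show "u \<in> {r *\<^sub>R w | r. 0 \<le> r}"
        using T(5) by (auto intro: sum_nonneg)
    next
      fix u assume "u \<in> {r *\<^sub>R w | r. 0 \<le> r}"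
      then obtain r where r: "r \<ge> 0" "u = r *\<^sub>R w" by blast
      have "w \<bullet> x \<le> w \<bullet> y" if "y \<in> P" for y
        using x(2) polarD[OF x(3) that] by simp
      then show "u \<in> normal_cone P {x}"
        using r unfolding normal_cone_def by (auto intro: mult_left_mono)
    qed
    then have "{r *\<^sub>R w | r. 0 \<le> r} \<in> normal_fan P"
      unfolding normal_fan_pointwise[OF P1(3)] using x(1) by blast
    then show "w \<in> rays (normal_fan P)"
      unfolding rays_def using prim[OF w] by blast
  next
    fix u assume "u \<in> rays (normal_fan P)"
    then have u: "primitive u" "{r *\<^sub>R u | r. 0 \<le> r} \<in> normal_fan P"
      unfolding rays_def by auto
    then obtain v where v: "v \<in> P" "{r *\<^sub>R u | r. 0 \<le> r} = normal_cone P {v}"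
      unfolding normal_fan_pointwise[OF P1(3)] by blast
    have "u = 1 *\<^sub>R u" by simp
    then have "u \<in> normal_cone P {v}"
      using v(2) zero_le_one by blast
    then obtain T c where T: "finite T" "T \<subseteq> verts (polar P)" "\<forall>e\<in>T. e \<bullet> v = -1"
      "\<forall>e\<in>T. e \<in> normal_cone P {v}"
      "\<forall>e\<in>T. c e \<ge> 0" "u = (\<Sum>e\<in>T. c e *\<^sub>R e)"
      by (rule normal_cone_spanned[OF L(2) _ v(1)])
    have "T \<noteq> {}" using T(6) u(1) unfolding primitive_def by auto
    then obtain e where e: "e \<in> T" by blast
    then obtain r where r: "e = r *\<^sub>R u" "r \<ge> 0"
      using T(4) v(2) by blast
    have "r = 1"
      using primitive_multiple[OF u(1), of r] prim e T(2) r by blast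
    then show "u \<in> verts (polar P)" using r e T(2) by auto
  qed
qed

section \<open>Convex piecewise linear functions\<close>

text \<open>The cone at a vertex is full-dimensional. Starting from an interior direction
  \<open>w\<close>, a short step towards any \<open>u\<close> stays in the cone, where \<phi> is
  linear; convexity along the segment then gives the inequality at \<open>u\<close>.\<close>

lemma convex_PL_subgradient:
  fixes P :: "'a::euclidean_space set"
  assumes P: "polytope P" and v: "v \<in> verts P"
    and PL: "integral_PL (normal_fan P) \<phi>" and conv: "convex_on UNIV \<phi>"
  obtains m where "m \<in> lattice_pts" "\<And>u. u \<in> normal_cone P {v} \<Longrightarrow> \<phi> u = m \<bullet> u"
    "\<And>u. m \<bullet> u \<le> \<phi> u"
proof -
  have cP: "convex P" using P by (rule polytope_imp_convex)
  have ve: "v extreme_point_of P" "v \<in> P"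
    using v unfolding verts_def extreme_point_of_def by auto
  then have "normal_cone P {v} \<in> normal_fan P"
    unfolding normal_fan_pointwise[OF cP] by blast
  then obtain m where m: "m \<in> lattice_pts" "\<And>u. u \<in> normal_cone P {v} \<Longrightarrow> \<phi> u = m \<bullet> u"
    using PL unfolding integral_PL_def by blast
  have "{v} exposed_face_of P"
    using ve P by (simp add: exposed_face_of_polyhedron face_of_singleton polytope_imp_polyhedron)
  then obtain a b where ab: "P \<subseteq> {x. a \<bullet> x \<le> b}" "{v} = P \<inter> {x. a \<bullet> x = b}"
    unfolding exposed_face_of_def by blast
  \<comment> \<open>The negative of the functional exposing \<open>v\<close> is strictly minimal at
    \<open>v\<close>, hence interior to the cone.\<close>
  define w where "w = - a"
  obtain V where V: "finite V" "P = convex hull V"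
    using P polytope_def by blast
  have w: "w \<bullet> (y - v) > 0" if "y \<in> V - {v}" for y
  proof -
    have "y \<in> P" using that V hull_subset by fast
    then have "a \<bullet> y < b" using ab that by force
    moreover have "a \<bullet> v = b" using ab by blast
    ultimately show ?thesis unfolding w_def by (simp add: inner_diff_right)
  qed
  have m_le: "m \<bullet> u \<le> \<phi> u" for u
  proof -
    have "eventually (\<lambda>e. ((1 - e) *\<^sub>R w + e *\<^sub>R u) \<bullet> (y - v) > 0) (at_right 0)"
      if "y \<in> V - {v}" for y
    proof -
      have "((\<lambda>e. ((1 - e) *\<^sub>R w + e *\<^sub>R u) \<bullet> (y - v)) \<longlongrightarrow>
          ((1 - 0) *\<^sub>R w + 0 *\<^sub>R u) \<bullet> (y - v)) (at_right 0)"
        by (intro tendsto_intros)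
      then show ?thesis
        using w[OF that] by (simp add: order_tendstoD(1))
    qed
    \<comment> \<open>Only the finitely many generators of \<open>P\<close> have to be tested, so
      one small \<open>e\<close> serves all of them.\<close>
    then have "eventually (\<lambda>e. \<forall>y\<in>V - {v}. ((1 - e) *\<^sub>R w + e *\<^sub>R u) \<bullet> (y - v) > 0) (at_right 0)"
      using V(1) by (simp add: eventually_ball_finite)
    moreover have "eventually (\<lambda>e::real. 0 < e \<and> e < 1) (at_right 0)"
      using eventually_at_right_real[of 0 1] by simp
    ultimately have "eventually (\<lambda>e. (\<forall>y\<in>V - {v}. ((1 - e) *\<^sub>R w + e *\<^sub>R u) \<bullet> (y - v) > 0)
        \<and> 0 < e \<and> e < 1) (at_right 0)"
      by (rule eventually_conj)
    then obtain e where e: "\<forall>y\<in>V - {v}. ((1 - e) *\<^sub>R w + e *\<^sub>R u) \<bullet> (y - v) > 0" "0 < e" "e < 1"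
      using eventually_happens' trivial_limit_at_right_real by blast
    define z where "z = (1 - e) *\<^sub>R w + e *\<^sub>R u"
    have "V \<subseteq> {y. z \<bullet> y \<ge> z \<bullet> v}"
    proof
      fix y assume "y \<in> V"
      then show "y \<in> {y. z \<bullet> y \<ge> z \<bullet> v}"
        using e(1) unfolding z_def[symmetric] by (cases "y = v") (auto simp: inner_diff_right less_imp_le)
    qed
    then have "P \<subseteq> {y. z \<bullet> y \<ge> z \<bullet> v}"
      unfolding V(2) by (simp add: convex_halfspace_ge subset_hull)
    then have "z \<in> normal_cone P {v}"
      unfolding normal_cone_def by auto
    moreover have wN: "w \<in> normal_cone P {v}"
      using ab unfolding normal_cone_def w_def by auto
    ultimately have eq: "\<phi> z = m \<bullet> z" "\<phi> w = m \<bullet> w" using m(2) by auto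
    \<comment> \<open>As \<phi> agrees with \<open>m\<close> at \<open>z\<close> and
      \<open>w\<close>, the contributions of \<open>w\<close> cancel and only those of
      \<open>u\<close> remain.\<close>
    have "\<phi> z \<le> (1 - e) * \<phi> w + e * \<phi> u"
      unfolding z_def using conv e by (simp add: convex_on_def)
    then have "e * (m \<bullet> u) \<le> e * \<phi> u"
      unfolding eq by (simp add: z_def inner_add_right)
    then show ?thesis using e by simp
  qed
  show ?thesis using that[OF m m_le] .
qed

lemma normal_cone_translate:
  "normal_cone ((+) a ` S) {a + x} = normal_cone S {x}"
  unfolding normal_cone_def by (auto simp: inner_add_right)

text \<open>Makes the fan of the dual model independent of the lift, since other lifts translate the
  polyhedron.\<close>

lemma normal_fan_translate:
  fixes S :: "'a::euclidean_space set"
  assumes "convex S"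
  shows "normal_fan ((+) a ` S) = normal_fan S"
proof -
  have "normal_fan ((+) a ` S) = {normal_cone ((+) a ` S) {a + x} | x. x \<in> S}"
    using assms by (auto simp: normal_fan_pointwise convex_translation)
  then show ?thesis
    by (simp only: normal_cone_translate normal_fan_pointwise[OF assms])
qed

section \<open>The dual nef partition\<close>

locale nef =
  fixes P :: "'a::euclidean_space set" and E :: "'c::finite \<Rightarrow> 'a set" and \<phi> :: "'c \<Rightarrow> 'a \<Rightarrow> real"
  assumes refl: "reflexive P" and nef: "nef_partition P E \<phi>"
begin

lemma E_Union: "(\<Union>j. E j) = verts (polar P)"
  using nef unfolding nef_partition_def by blast

lemma \<phi>_E: "e \<in> E j \<Longrightarrow> \<phi> i e = (if i = j then 1 else 0)"
  using nef unfolding nef_partition_def by blast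

lemma \<phi>_verts: "e \<in> verts (polar P) \<Longrightarrow> \<phi> i e \<in> {0, 1}"
  using \<phi>_E unfolding E_Union[symmetric] by auto

lemma \<phi>_convex: "convex_on UNIV (\<phi> i)"
  using nef unfolding nef_partition_def by blast

lemma \<phi>_subgradient:
  assumes "v \<in> verts P"
  shows "\<exists>m\<in>lattice_pts. (\<forall>u\<in>normal_cone P {v}. \<phi> i u = m \<bullet> u) \<and> (\<forall>u. m \<bullet> u \<le> \<phi> i u)"
proof -
  have "polytope P" using refl lattice_polytopeD(1) unfolding reflexive_def by blast
  moreover have "integral_PL (normal_fan P) (\<phi> i)"
    using nef unfolding nef_partition_def by blast
  ultimately show ?thesis
    using convex_PL_subgradient[OF _ assms _ \<phi>_convex] by metis
qed

lemma vertex_cone: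
  obtains v where "v \<in> verts P" "v \<in> P" "\<nu> \<in> normal_cone P {v}"
proof -
  have "compact P" "convex P" "P \<noteq> {}"
    using refl lattice_polytopeD(2,3) reflexive_facts(3) unfolding reflexive_def by blast+
  then obtain v where "v \<in> verts P" "\<nu> \<in> normal_cone P {v}"
    by (rule minimum_at_vertex)
  then show ?thesis using that unfolding verts_def extreme_point_of_def by blast
qed

text \<open>All \<phi> i are linear on the same cone, so one combination of its generators computes
  all of them at once.\<close>

lemma \<phi>_decomp:
  obtains T c where "finite T" "T \<subseteq> verts (polar P)" "\<forall>e\<in>T. c e \<ge> 0"
    "\<nu> = (\<Sum>e\<in>T. c e *\<^sub>R e)" "\<forall>i. \<phi> i \<nu> = (\<Sum>e\<in>T. c e * \<phi> i e)"
proof -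
  obtain v where v: "v \<in> verts P" "v \<in> P" "\<nu> \<in> normal_cone P {v}"
    by (rule vertex_cone)
  have int: "0 \<in> interior P" using refl unfolding reflexive_def by blast
  obtain T c where T: "finite T" "T \<subseteq> verts (polar P)" "\<forall>e\<in>T. e \<bullet> v = -1"
    "\<forall>e\<in>T. e \<in> normal_cone P {v}" "\<forall>e\<in>T. c e \<ge> 0" "\<nu> = (\<Sum>e\<in>T. c e *\<^sub>R e)"
    by (rule normal_cone_spanned[OF int v(3,2)])
  have "\<phi> i \<nu> = (\<Sum>e\<in>T. c e * \<phi> i e)" for i
  proof -
    obtain m where m: "\<forall>u\<in>normal_cone P {v}. \<phi> i u = m \<bullet> u"
      using \<phi>_subgradient[OF v(1)] by blast
    have "\<phi> i \<nu> = m \<bullet> \<nu>" using m v(3) by blast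
    also have "\<dots> = (\<Sum>e\<in>T. c e * (m \<bullet> e))"
      unfolding T(6) by (simp add: inner_sum_right)
    also have "\<dots> = (\<Sum>e\<in>T. c e * \<phi> i e)"
      using m T(4) by (intro sum.cong) auto
    finally show ?thesis .
  qed
  then show ?thesis using that T by blast
qed

lemma \<phi>_nonneg: "\<phi> i \<nu> \<ge> 0"
proof -
  obtain T c where T: "T \<subseteq> verts (polar P)" "\<forall>e\<in>T. c e \<ge> 0" "\<phi> i \<nu> = (\<Sum>e\<in>T. c e * \<phi> i e)"
    by (rule \<phi>_decomp[of \<nu>]) blast
  have "\<phi> i e \<ge> 0" if "e \<in> T" for e
    using \<phi>_verts[OF subsetD[OF T(1) that], of i] by auto
  then show ?thesis
    unfolding T(3) using T(2) by (intro sum_nonneg mult_nonneg_nonneg) auto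
qed

lemma \<phi>_zero: "\<phi> i 0 = 0"
  by (rule vertex_cone[of 0]) (use \<phi>_subgradient[of _ i] in fastforce)

text \<open>The origin is included so that combinations of \<open>E j\<close> with total weight
  below 1 belong to the set.\<close>

definition B :: "'c \<Rightarrow> 'a set" where
  "B j = convex hull (insert 0 (E j))"

text \<open>A convex function on a hull is bounded by its values at the generators.\<close>

lemma \<phi>_B:
  assumes "b \<in> B j"
  shows "\<phi> i b \<le> (if i = j then 1 else 0)"
proof -
  have "\<forall>x\<in>insert 0 (E j). \<phi> i x \<le> (if i = j then 1 else 0)"
    using \<phi>_E \<phi>_zero by auto
  moreover have "convex_on (convex hull (insert 0 (E j))) (\<phi> i)"
    using \<phi>_convex[of i] by (auto intro: convex_on_subset)
  ultimately show ?thesis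
    using convex_on_convex_hull_bound assms unfolding B_def by metis
qed

text \<open>The basic inequality between the nef partition and its dual. It bounds the points of
  \<open>nabla\<close> from one side and the summands of the mirror polytope from the other.\<close>

lemma nabla_B:
  assumes "\<mu> \<in> nabla (\<phi> j)" "b \<in> B i"
  shows "\<mu> \<bullet> b \<ge> - (if j = i then 1 else 0)"
proof -
  have "\<mu> \<bullet> b \<ge> - \<phi> j b"
    using assms(1) unfolding nabla_def by (auto simp: inner_commute[of \<mu>])
  then show ?thesis using \<phi>_B[OF assms(2), of j] by linarith
qed

lemma zero_in_B: "0 \<in> B j"
  unfolding B_def by (simp add: hull_inc)

lemma E_subset_B: "E j \<subseteq> B j"
  unfolding B_def by (meson hull_subset insert_subset)

text \<open>Every vector is a nonnegative combination of ray generators on which \<phi> j is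
  additive. This identifies \<open>nabla\<close> with the polytope of sections of the original
  divisor.\<close>

lemma nabla_eq:
  "nabla (\<phi> j) = {\<mu>. \<forall>e\<in>verts (polar P). e \<bullet> \<mu> \<ge> - \<phi> j e}"
proof (intro equalityI subsetI)
  fix \<mu> assume \<mu>: "\<mu> \<in> {\<mu>. \<forall>e\<in>verts (polar P). e \<bullet> \<mu> \<ge> - \<phi> j e}"
  have "\<nu> \<bullet> \<mu> \<ge> - \<phi> j \<nu>" for \<nu>
  proof -
    obtain T c where T: "T \<subseteq> verts (polar P)" "\<forall>e\<in>T. c e \<ge> 0" "\<nu> = (\<Sum>e\<in>T. c e *\<^sub>R e)"
      "\<phi> j \<nu> = (\<Sum>e\<in>T. c e * \<phi> j e)"
      by (rule \<phi>_decomp[of \<nu>]) blast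
    have "- \<phi> j \<nu> = (\<Sum>e\<in>T. c e * (- \<phi> j e))"
      unfolding T(4) by (simp add: sum_negf)
    also have "\<dots> \<le> (\<Sum>e\<in>T. c e * (e \<bullet> \<mu>))"
      using T \<mu> by (intro sum_mono mult_left_mono) auto
    also have "\<dots> = \<nu> \<bullet> \<mu>"
      unfolding T(3) by (simp add: inner_sum_left)
    finally show ?thesis .
  qed
  then show "\<mu> \<in> nabla (\<phi> j)" unfolding nabla_def by blast
qed (auto simp: nabla_def)

text \<open>By convexity the negated local data of \<phi> j at the vertices of \<open>P\<close> lie
  in \<open>nabla (\<phi> j)\<close>, and each linear form attains its lower bound on
  \<open>nabla (\<phi> j)\<close> at one of them. Separation shows that their hull is
  everything.\<close>

lemma nabla_lattice_polytope: "lattice_polytope (nabla (\<phi> j))"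
proof -
  have "\<forall>v\<in>verts P. \<exists>m. m \<in> lattice_pts \<and>
      (\<forall>u\<in>normal_cone P {v}. \<phi> j u = m \<bullet> u) \<and> (\<forall>u. m \<bullet> u \<le> \<phi> j u)"
    using \<phi>_subgradient by blast
  then obtain m where m: "\<forall>v\<in>verts P. m v \<in> lattice_pts \<and>
      (\<forall>u\<in>normal_cone P {v}. \<phi> j u = m v \<bullet> u) \<and> (\<forall>u. m v \<bullet> u \<le> \<phi> j u)"
    by metis
  define A where "A = (\<lambda>v. - m v) ` verts P"
  have "finite (verts P)"
    using refl lattice_polytopeD(5) unfolding reflexive_def by blast
  then have A: "finite A" "A \<subseteq> lattice_pts"
    unfolding A_def using m lattice_uminus by auto
  have A_nabla: "A \<subseteq> nabla (\<phi> j)"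
    unfolding A_def nabla_def using m by (auto simp: inner_commute)
  have "nabla (\<phi> j) = (\<Inter>\<nu>. {\<mu>. \<nu> \<bullet> \<mu> \<ge> - \<phi> j \<nu>})"
    unfolding nabla_def by blast
  then have "convex (nabla (\<phi> j))"
    by (simp add: convex_INT convex_halfspace_ge)
  then have 1: "convex hull A \<subseteq> nabla (\<phi> j)"
    using A_nabla by (simp add: subset_hull)
  have "nabla (\<phi> j) \<subseteq> convex hull A"
  proof (rule ccontr)
    assume "\<not> nabla (\<phi> j) \<subseteq> convex hull A"
    then obtain z where z: "z \<in> nabla (\<phi> j)" "z \<notin> convex hull A" by blast
    have "closed (convex hull A)"
      using A(1) by (simp add: finite_imp_compact_convex_hull compact_imp_closed)
    then obtain a b where ab: "a \<bullet> z < b" "\<forall>x\<in>convex hull A. a \<bullet> x > b"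
      using separating_hyperplane_closed_point[of "convex hull A" z] z(2) by auto
    \<comment> \<open>The local data of the cone containing the separating form \<open>a\<close>
      give a point of the hull where \<open>a\<close> is at most its value at
      \<open>z\<close>.\<close>
    obtain v where v: "v \<in> verts P" "a \<in> normal_cone P {v}"
      using vertex_cone by blast
    have "- m v \<in> convex hull A"
      using v(1) unfolding A_def by (simp add: hull_inc)
    then have "a \<bullet> (- m v) > b" using ab(2) by blast
    moreover have "\<phi> j a = m v \<bullet> a" using m v by blast
    moreover have "a \<bullet> z \<ge> - \<phi> j a" using z(1) unfolding nabla_def by blast
    ultimately show False using ab(1) by (simp add: inner_commute)
  qed
  then have "nabla (\<phi> j) = convex hull A" using 1 by blast
  then show ?thesis
    unfolding lattice_polytope_def using A by blast
qed

text \<open>The support bound is reached at an integral point, so inequalities indexed by monomials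
  are as strong as those indexed by all of \<open>nabla\<close>.\<close>

lemma nabla_attained: "\<exists>\<mu>\<in>nabla (\<phi> j) \<inter> lattice_pts. \<nu> \<bullet> \<mu> = - \<phi> j \<nu>"
proof -
  obtain v where v: "v \<in> verts P" "\<nu> \<in> normal_cone P {v}"
    using vertex_cone by blast
  obtain m where m: "m \<in> lattice_pts" "\<phi> j \<nu> = m \<bullet> \<nu>" "\<forall>u. m \<bullet> u \<le> \<phi> j u"
    using \<phi>_subgradient[OF v(1)] v(2) by blast
  then have "- m \<in> nabla (\<phi> j) \<inter> lattice_pts"
    by (simp add: nabla_def lattice_uminus inner_commute)
  then show ?thesis using m(2) by (force simp: inner_commute)
qed

lemma nabla_zero: "0 \<in> nabla (\<phi> j)"
  unfolding nabla_def using \<phi>_nonneg by simp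

text \<open>Over a common cone every vector is a nonnegative combination of ray generators, and the
  coefficients belonging to \<open>E j\<close> add up to the value of \<open>\<phi> j\<close>.\<close>

lemma minkowski_decomp:
  assumes c: "\<And>j. c j > 0" and \<nu>: "\<And>j \<mu>. \<mu> \<in> nabla (\<phi> j) \<Longrightarrow> \<mu> \<in> lattice_pts \<Longrightarrow> \<mu> \<bullet> \<nu> + c j \<ge> 0"
  obtains b where "\<forall>j. b j \<in> B j" "\<nu> = (\<Sum>j\<in>UNIV. c j *\<^sub>R b j)"
proof -
  obtain T d where T: "finite T" "T \<subseteq> verts (polar P)" "\<forall>e\<in>T. d e \<ge> 0"
    "\<nu> = (\<Sum>e\<in>T. d e *\<^sub>R e)" "\<forall>i. \<phi> i \<nu> = (\<Sum>e\<in>T. d e * \<phi> i e)"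
    by (rule \<phi>_decomp)
  have \<phi>c: "\<phi> j \<nu> \<le> c j" for j
  proof -
    obtain \<mu> where "\<mu> \<in> nabla (\<phi> j)" "\<mu> \<in> lattice_pts" "\<nu> \<bullet> \<mu> = - \<phi> j \<nu>"
      using nabla_attained by blast
    then show ?thesis using \<nu>[of \<mu> j] by (simp add: inner_commute)
  qed
  \<comment> \<open>The part of the combination supported on \<open>E j\<close>, divided by the
    weight \<open>c j\<close>.\<close>
  define b where "b j = (\<Sum>e\<in>T \<inter> E j. (d e / c j) *\<^sub>R e)" for j
  have "b j \<in> B j" for j
  proof -
    have s: "(\<Sum>e\<in>T \<inter> E j. d e / c j) \<le> 1"
    proof -
      have "(\<Sum>e\<in>T \<inter> E j. d e) = (\<Sum>e\<in>T \<inter> E j. d e * \<phi> j e)"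
        using \<phi>_E by (intro sum.cong) auto
      also have "\<dots> \<le> \<phi> j \<nu>"
      proof -
        have "\<phi> j e \<ge> 0" for e by (rule \<phi>_nonneg)
        then show ?thesis
          unfolding T(5)[rule_format] using T(1,3) by (intro sum_mono2) auto
      qed
      finally show ?thesis
        using \<phi>c[of j] c[of j] by (simp add: sum_divide_distrib[symmetric])
    qed
    \<comment> \<open>The missing weight is placed at 0, which is not in \<open>E j\<close> because
      \<phi> j vanishes there.\<close>
    define a where "a e = (if e = 0 then 1 - (\<Sum>e\<in>T \<inter> E j. d e / c j) else d e / c j)" for e
    have nz: "0 \<notin> T \<inter> E j" using \<phi>_E[of 0 j j] \<phi>_zero[of j] by auto
    then have a: "a e = d e / c j" if "e \<in> T \<inter> E j" for e
      using that unfolding a_def by auto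
    have "(\<Sum>e\<in>insert 0 (T \<inter> E j). a e *\<^sub>R e) \<in> B j"
    proof (rule convex_sum)
      show "convex (B j)" unfolding B_def by simp
      show "(\<Sum>e\<in>insert 0 (T \<inter> E j). a e) = 1"
        using T(1) nz a by (simp add: a_def)
      show "e \<in> B j" if "e \<in> insert 0 (T \<inter> E j)" for e
        using that zero_in_B E_subset_B by blast
      show "0 \<le> a e" if "e \<in> insert 0 (T \<inter> E j)" for e
        using that s T(3) c[of j] unfolding a_def by auto
    qed (use T(1) in auto)
    moreover have "(\<Sum>e\<in>insert 0 (T \<inter> E j). a e *\<^sub>R e) = b j"
      unfolding b_def using T(1) nz a by simp
    ultimately show ?thesis by simp
  qed
  moreover have "\<nu> = (\<Sum>j\<in>UNIV. c j *\<^sub>R b j)"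
  proof -
    have T_eq: "T = (\<Union>j\<in>UNIV. T \<inter> E j)" using T(2) E_Union by blast
    have disj: "E i \<inter> E j = {}" if "i \<noteq> j" for i j
      using nef that unfolding nef_partition_def disjoint_family_on_def by blast
    have "(\<Sum>e\<in>(\<Union>j\<in>UNIV. T \<inter> E j). d e *\<^sub>R e) = (\<Sum>j\<in>UNIV. \<Sum>e\<in>T \<inter> E j. d e *\<^sub>R e)"
      using T(1) disj by (intro sum.UNION_disjoint) auto
    also have "\<dots> = (\<Sum>j\<in>UNIV. c j *\<^sub>R b j)"
      unfolding b_def using c by (simp add: scaleR_sum_right less_imp_neq[THEN not_sym])
    finally show ?thesis using T(4) T_eq by simp
  qed
  ultimately show ?thesis using that by blast
qed

text \<open>Converse to \<open>minkowski_decomp\<close>: by \<open>nabla_B\<close> only the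
  \<open>j\<close>-th summand can pair negatively with a point of \<open>nabla (\<phi> j)\<close>,
  contributing at least -\<open>c j\<close>.\<close>

lemma minkowski_nabla:
  assumes c: "\<And>j. c j \<ge> 0" and b: "\<And>j. b j \<in> B j" and \<mu>: "\<mu> \<in> nabla (\<phi> j)"
  shows "\<mu> \<bullet> (\<Sum>i\<in>UNIV. c i *\<^sub>R b i) + c j \<ge> 0"
proof -
  have "- c j = (\<Sum>i\<in>UNIV. c i * (- (if j = i then 1 else 0)))"
    by (simp add: sum_negf if_distrib[of "\<lambda>x. _ * x"] cong: if_cong)
  also have "\<dots> \<le> (\<Sum>i\<in>UNIV. c i * (\<mu> \<bullet> b i))"
    using nabla_B[OF \<mu> b] c by (intro sum_mono mult_left_mono) auto
  finally show ?thesis by (simp add: inner_sum_right)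
qed

section \<open>The mirror polytope and its polar\<close>

lemma mirror_polytope_halfspaces:
  "mirror_polytope \<phi> = {\<nu>. \<forall>j. \<forall>\<mu>\<in>nabla (\<phi> j). \<mu> \<bullet> \<nu> + 1 \<ge> 0}"
  unfolding mirror_polytope_def polar_convex_hull by (auto simp: polar_def)

text \<open>The two Minkowski lemmas with all weights equal to 1.\<close>

lemma mirror_polytope_eq:
  "mirror_polytope \<phi> = {\<Sum>j\<in>UNIV. b j | b. \<forall>j. b j \<in> B j}"
proof (intro equalityI subsetI)
  fix \<nu> assume "\<nu> \<in> mirror_polytope \<phi>"
  then have "\<And>j \<mu>. \<mu> \<in> nabla (\<phi> j) \<Longrightarrow> \<mu> \<in> lattice_pts \<Longrightarrow> \<mu> \<bullet> \<nu> + (\<lambda>_. 1) j \<ge> 0"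
    unfolding mirror_polytope_halfspaces by blast
  then obtain b where "\<forall>j. b j \<in> B j" "\<nu> = (\<Sum>j\<in>UNIV. (\<lambda>_. 1) j *\<^sub>R b j)"
    by (rule minkowski_decomp[rotated]) simp_all
  then show "\<nu> \<in> {\<Sum>j\<in>UNIV. b j | b. \<forall>j. b j \<in> B j}" by auto
next
  fix \<nu> assume "\<nu> \<in> {\<Sum>j\<in>UNIV. b j | b. \<forall>j. b j \<in> B j}"
  then obtain b where b: "\<forall>j. b j \<in> B j" "\<nu> = (\<Sum>j\<in>UNIV. b j)" by blast
  then show "\<nu> \<in> mirror_polytope \<phi>"
    unfolding mirror_polytope_halfspaces using minkowski_nabla[of "\<lambda>_. 1" b] by simp
qed

lemma finite_E: "finite (E j)" and E_lattice: "E j \<subseteq> lattice_pts"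
proof -
  have "E j \<subseteq> verts (polar P)" using E_Union by blast
  then show "finite (E j)" "E j \<subseteq> lattice_pts"
    using refl lattice_polytopeD(4,5) finite_subset unfolding reflexive_def by blast+
qed

text \<open>A Minkowski sum of hulls is the hull of the Minkowski sum of the generating sets, here a
  finite set of integral points.\<close>

lemma mirror_polytope_lattice: "lattice_polytope (mirror_polytope \<phi>)"
proof -
  have "mirror_polytope \<phi> = (\<Sum>j\<in>UNIV. B j)"
    unfolding mirror_polytope_eq by (simp add: set_sum_alt)
  also have "\<dots> = convex hull (\<Sum>j\<in>UNIV. insert 0 (E j))"
    unfolding B_def by (rule convex_hull_set_sum[symmetric])
  finally have eq: "mirror_polytope \<phi> = convex hull (\<Sum>j\<in>UNIV. insert 0 (E j))" .
  have "finite (\<Sum>j\<in>UNIV. insert 0 (E j))"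
    using finite_E by (intro finite_set_sum) auto
  moreover have "(\<Sum>j\<in>UNIV. insert 0 (E j)) \<subseteq> lattice_pts"
  proof
    fix x assume "x \<in> (\<Sum>j\<in>UNIV. insert 0 (E j))"
    then obtain s where s: "x = sum s UNIV" "\<forall>j. s j \<in> insert 0 (E j)"
      by (auto simp: set_sum_alt)
    have "s j \<in> lattice_pts" for j
      using s(2)[rule_format, of j] E_lattice[of j] by auto
    then show "x \<in> lattice_pts"
      unfolding s(1) by (intro lattice_sum)
  qed
  ultimately show ?thesis unfolding lattice_polytope_def using eq by blast
qed

abbreviation R :: "'a set" where
  "R \<equiv> convex hull (\<Union>j. nabla (\<phi> j))"

lemma R_lattice_polytope: "lattice_polytope R"
proof -
  have "\<forall>j. \<exists>V. finite V \<and> V \<subseteq> lattice_pts \<and> nabla (\<phi> j) = convex hull V"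
    using nabla_lattice_polytope unfolding lattice_polytope_def by blast
  then obtain V where V: "\<And>j. finite (V j)" "\<And>j. V j \<subseteq> lattice_pts"
    "\<And>j. nabla (\<phi> j) = convex hull (V j)" by metis
  have "R = convex hull (\<Union>j. V j)"
  proof
    have "nabla (\<phi> j) \<subseteq> convex hull (\<Union>j. V j)" for j
      unfolding V(3) by (intro hull_mono) blast
    then show "R \<subseteq> convex hull (\<Union>j. V j)"
      by (simp add: UN_least subset_hull)
    have "V j \<subseteq> nabla (\<phi> j)" for j
      unfolding V(3) by (rule hull_subset)
    then show "convex hull (\<Union>j. V j) \<subseteq> R"
      by (intro hull_mono) blast
  qed
  then show ?thesis
    unfolding lattice_polytope_def using V by (intro exI[of _ "\<Union>j. V j"]) auto
qed

lemma polar_mirror: "polar (mirror_polytope \<phi>) = R"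
proof -
  have "0 \<in> R" using nabla_zero by (intro hull_inc) blast
  moreover have "compact R" using R_lattice_polytope lattice_polytopeD(2) by blast
  ultimately show ?thesis
    unfolding mirror_polytope_def
    by (intro polar_polar) (auto simp: compact_imp_closed convex_convex_hull)
qed

lemma mirror_reflexive: "reflexive (mirror_polytope \<phi>)"
proof -
  have "bounded R"
    using R_lattice_polytope lattice_polytopeD(2) compact_imp_bounded by blast
  then have "0 \<in> interior (mirror_polytope \<phi>)"
    unfolding mirror_polytope_def by (rule zero_in_interior_polar)
  then show ?thesis
    unfolding reflexive_def using mirror_polytope_lattice R_lattice_polytope by (simp add: polar_mirror)
qed

section \<open>Rays of the mirror fan and mirror divisors\<close>

lemma rays_mirror: "rays (mirror_fan \<phi>) = verts R"
  unfolding mirror_fan_def rays_normal_fan[OF mirror_reflexive] polar_mirror ..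

text \<open>With \<open>w\<close> in \<open>nabla (\<phi> i)\<close>, the lower bounds of
  \<open>nabla_B\<close> add up to -1, which is the actual total; hence each bound is an equality.
  The value -1 at \<open>b i\<close> then keeps \<open>w\<close> out of all other
  \<open>nabla (\<phi> j)\<close>.\<close>

lemma mirror_ray_inner:
  assumes w: "w \<in> rays (mirror_fan \<phi>)" and b: "\<And>j. b j \<in> B j" and eq: "w \<bullet> (\<Sum>j\<in>UNIV. b j) = -1"
  shows "w \<bullet> b j = - of_int (mirror_divisor \<phi> j w)"
    and "\<exists>i. w \<in> nabla (\<phi> i) \<and> (\<forall>j. mirror_divisor \<phi> j w = (if j = i then 1 else 0))"
proof -
  have wR: "w extreme_point_of R"
    using w unfolding rays_mirror verts_def by blast
  then obtain i where i: "w \<in> nabla (\<phi> i)"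
    using extreme_point_of_convex_hull by blast
  have "w \<noteq> 0" using eq by auto
  have ge: "w \<bullet> b j + (if i = j then 1 else 0) \<ge> 0" for j
    using nabla_B[OF i b, of j] by linarith
  have "(\<Sum>j\<in>UNIV. w \<bullet> b j + (if i = j then 1 else 0)) = 0"
    using eq by (simp add: sum.distrib inner_sum_right)
  then have "\<forall>j\<in>UNIV. w \<bullet> b j + (if i = j then 1 else 0) = 0"
    using ge by (subst (asm) sum_nonneg_eq_0_iff) auto
  then have val: "w \<bullet> b j = - (if i = j then 1 else 0)" for j
    by (simp add: eq_neg_iff_add_eq_0)
  have div: "mirror_divisor \<phi> j w = (if j = i then 1 else 0)" for j
  proof (cases "j = i")
    case True
    have sub: "convex hull (nabla (\<phi> i) - {0}) \<subseteq> R"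
      by (intro hull_mono) blast
    have "w \<in> convex hull (nabla (\<phi> i) - {0})"
      using i \<open>w \<noteq> 0\<close> by (intro hull_inc) blast
    \<comment> \<open>Extremality in \<open>R\<close> passes to a subset that contains the
      point.\<close>
    then have "w extreme_point_of convex hull (nabla (\<phi> i) - {0})"
      using wR sub unfolding extreme_point_of_def by blast
    then show ?thesis using True unfolding mirror_divisor_def verts_def by simp
  next
    case False
    have "w \<notin> nabla (\<phi> j)"
      using nabla_B[of w j "b i" i] b val[of i] False by auto
    then have "w \<notin> verts (convex hull (nabla (\<phi> j) - {0}))"
      unfolding verts_def using extreme_point_of_convex_hull by blast
    then show ?thesis using False unfolding mirror_divisor_def by simp
  qed
  show "w \<bullet> b j = - of_int (mirror_divisor \<phi> j w)"
    unfolding val div by auto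
  show "\<exists>i. w \<in> nabla (\<phi> i) \<and> (\<forall>j. mirror_divisor \<phi> j w = (if j = i then 1 else 0))"
    using i div by blast
qed

lemma mirror_ray_exposed:
  assumes "w \<in> rays (mirror_fan \<phi>)"
  obtains b where "\<forall>j. b j \<in> B j" "w \<bullet> (\<Sum>j\<in>UNIV. b j) = -1"
proof -
  have "w \<in> verts (polar (mirror_polytope \<phi>))"
    using assms unfolding rays_mirror polar_mirror .
  then obtain x where x: "x \<in> mirror_polytope \<phi>" "w \<bullet> x = -1"
    using extreme_dual_exposed[OF mirror_reflexive] by metis
  then show ?thesis using that unfolding mirror_polytope_eq by blast
qed

lemma mirror_ray_nabla:
  assumes "w \<in> rays (mirror_fan \<phi>)"
  obtains i where "w \<in> nabla (\<phi> i)" "w \<in> lattice_pts" "w \<noteq> 0"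
    "\<forall>j. mirror_divisor \<phi> j w = (if j = i then 1 else 0)"
proof -
  have "primitive w" using assms unfolding rays_def by blast
  then have "w \<in> lattice_pts" "w \<noteq> 0" unfolding primitive_def by auto
  then show ?thesis
    using that mirror_ray_exposed[OF assms] mirror_ray_inner(2)[OF assms] by metis
qed

section \<open>Local data of the mirror divisors on normal cones\<close>

text \<open>A form is minimal on a Minkowski sum iff it is minimal on every summand; exchanging one
  summand at a time gives the forward direction.\<close>

lemma normal_cone_mirror:
  assumes b: "\<And>j. b j \<in> B j"
  shows "u \<in> normal_cone (mirror_polytope \<phi>) {\<Sum>j\<in>UNIV. b j} \<longleftrightarrow> (\<forall>j. \<forall>b'\<in>B j. u \<bullet> b j \<le> u \<bullet> b')"
proof
  assume u: "u \<in> normal_cone (mirror_polytope \<phi>) {\<Sum>j\<in>UNIV. b j}"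
  show "\<forall>j. \<forall>b'\<in>B j. u \<bullet> b j \<le> u \<bullet> b'"
  proof clarify
    fix j b' assume b': "b' \<in> B j"
    have "(\<Sum>i\<in>UNIV. (b(j := b')) i) \<in> mirror_polytope \<phi>"
      unfolding mirror_polytope_eq using b b' by (intro CollectI exI[of _ "b(j := b')"]) auto
    then have "u \<bullet> (\<Sum>i\<in>UNIV. b i) \<le> u \<bullet> (\<Sum>i\<in>UNIV. (b(j := b')) i)"
      using u unfolding normal_cone_def by blast
    also have "(\<Sum>i\<in>UNIV. (b(j := b')) i) = b' + (\<Sum>i\<in>UNIV - {j}. b i)"
      by (subst sum.remove[of _ j]) (auto intro: sum.cong)
    also have "(\<Sum>i\<in>UNIV. b i) = b j + (\<Sum>i\<in>UNIV - {j}. b i)"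
      by (subst sum.remove[of _ j]) auto
    finally show "u \<bullet> b j \<le> u \<bullet> b'" by (simp add: inner_add_right)
  qed
next
  assume "\<forall>j. \<forall>b'\<in>B j. u \<bullet> b j \<le> u \<bullet> b'"
  then show "u \<in> normal_cone (mirror_polytope \<phi>) {\<Sum>j\<in>UNIV. b j}"
    unfolding normal_cone_def mirror_polytope_eq
    by (auto simp: inner_sum_right intro!: sum_mono)
qed

text \<open>A ray generator takes the value -1 somewhere on the mirror polytope and is never
  smaller, so this is its value wherever it is minimal; \<open>mirror_ray_inner\<close> splits it
  among the summands.\<close>

lemma cone_ray_value:
  assumes b: "\<And>j. b j \<in> B j" and w: "w \<in> rays (mirror_fan \<phi>)"
    and wN: "w \<in> normal_cone (mirror_polytope \<phi>) {\<Sum>j\<in>UNIV. b j}"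
  shows "w \<bullet> b j = - of_int (mirror_divisor \<phi> j w)"
proof -
  have bQ: "(\<Sum>j\<in>UNIV. b j) \<in> mirror_polytope \<phi>"
    unfolding mirror_polytope_eq using b by blast
  obtain b' where b': "\<forall>j. b' j \<in> B j" "w \<bullet> (\<Sum>j\<in>UNIV. b' j) = -1"
    using mirror_ray_exposed[OF w] by blast
  then have "(\<Sum>j\<in>UNIV. b' j) \<in> mirror_polytope \<phi>"
    unfolding mirror_polytope_eq by blast
  then have "w \<bullet> (\<Sum>j\<in>UNIV. b j) \<le> -1"
    using wN b'(2) unfolding normal_cone_def by force
  moreover have "w \<in> polar (mirror_polytope \<phi>)"
    using w unfolding rays_mirror polar_mirror verts_def extreme_point_of_def by blast
  ultimately have "w \<bullet> (\<Sum>j\<in>UNIV. b j) = -1"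
    using polarD bQ by force
  then show ?thesis by (rule mirror_ray_inner(1)[OF w b])
qed

text \<open>The cone is spanned by ray generators, where both sides agree. So local data are
  determined on the cone, whichever representative \<open>m\<close> is chosen.\<close>

lemma cone_cartier_data:
  assumes b: "\<And>j. b j \<in> B j"
    and m: "\<And>w. w \<in> rays (mirror_fan \<phi>) \<Longrightarrow> w \<in> normal_cone (mirror_polytope \<phi>) {\<Sum>j\<in>UNIV. b j}
      \<Longrightarrow> m \<bullet> w = of_int (mirror_divisor \<phi> j w)"
    and u: "u \<in> normal_cone (mirror_polytope \<phi>) {\<Sum>j\<in>UNIV. b j}"
  shows "m \<bullet> u = - (u \<bullet> b j)"
proof -
  have bQ: "(\<Sum>j\<in>UNIV. b j) \<in> mirror_polytope \<phi>"
    unfolding mirror_polytope_eq using b by blast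
  have int: "0 \<in> interior (mirror_polytope \<phi>)"
    using mirror_reflexive unfolding reflexive_def by blast
  obtain T c where T: "finite T" "T \<subseteq> verts (polar (mirror_polytope \<phi>))"
    "\<forall>e\<in>T. e \<bullet> (\<Sum>j\<in>UNIV. b j) = -1"
    "\<forall>e\<in>T. e \<in> normal_cone (mirror_polytope \<phi>) {\<Sum>j\<in>UNIV. b j}" "\<forall>e\<in>T. c e \<ge> 0"
    "u = (\<Sum>e\<in>T. c e *\<^sub>R e)"
    by (rule normal_cone_spanned[OF int u bQ])
  have "m \<bullet> e = - (e \<bullet> b j)" if "e \<in> T" for e
    using m[of e] cone_ray_value[OF b, of e j] T(2,4) that
    unfolding rays_mirror polar_mirror by auto
  then have "(\<Sum>e\<in>T. c e * (m \<bullet> e)) = (\<Sum>e\<in>T. c e * (- (e \<bullet> b j)))"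
    by (intro sum.cong) auto
  then show ?thesis
    unfolding T(6) by (simp add: inner_sum_right inner_sum_left sum_negf)
qed

text \<open>The point \<open>b j\<close> need not be integral. A form minimal at \<open>b j\<close>
  is also minimal at each generator of positive weight in \<open>b j\<close>, and the negative of
  such an integral generator serves as local data.\<close>

lemma cone_cartier_exists:
  assumes b: "\<And>j. b j \<in> B j"
  obtains m where "m \<in> lattice_pts"
    "\<And>u. u \<in> normal_cone (mirror_polytope \<phi>) {\<Sum>j\<in>UNIV. b j} \<Longrightarrow> m \<bullet> u = - (u \<bullet> b j)"
proof -
  obtain T c where T: "finite T" "T \<subseteq> insert 0 (E j)" "\<forall>v\<in>T. 0 \<le> c v" "sum c T = 1"
    "(\<Sum>v\<in>T. c v *\<^sub>R v) = b j"
    using b[of j] unfolding B_def convex_hull_explicit by blast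
  obtain v where v: "v \<in> T" "c v > 0"
    using T(3,4) by (metis less_eq_real_def sum.neutral zero_neq_one)
  have lat: "v \<in> lattice_pts" using v T(2) E_lattice lattice_zero by blast
  have val: "u \<bullet> v = u \<bullet> b j"
    if u: "u \<in> normal_cone (mirror_polytope \<phi>) {\<Sum>j\<in>UNIV. b j}" for u
  proof -
    have "T \<subseteq> B j" using T(2) E_subset_B zero_in_B by blast
    then have ge: "u \<bullet> b j \<le> u \<bullet> x" if "x \<in> T" for x
      using u that unfolding normal_cone_mirror[OF b] by blast
    have "(\<Sum>x\<in>T. c x * (u \<bullet> x - u \<bullet> b j)) = u \<bullet> (\<Sum>x\<in>T. c x *\<^sub>R x) - sum c T * (u \<bullet> b j)"
      by (simp add: inner_sum_right right_diff_distrib sum_subtractf sum_distrib_right)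
    \<comment> \<open>The excess over the minimum has weighted mean 0 and is nonnegative, so it
      vanishes where the weight is positive.\<close>
    then have "(\<Sum>x\<in>T. c x * (u \<bullet> x - u \<bullet> b j)) = 0"
      unfolding T(4,5) by simp
    then have "\<forall>x\<in>T. c x * (u \<bullet> x - u \<bullet> b j) = 0"
      by (subst (asm) sum_nonneg_eq_0_iff) (use T(1,3) ge in auto)
    then show ?thesis using v by force
  qed
  show ?thesis
    using that[OF lattice_uminus[OF lat]] val by (auto simp: inner_commute[of v])
qed

end

section \<open>Total spaces and the dual polyhedron\<close>

lemma lattice_Pair: "(x, t) \<in> lattice_pts \<longleftrightarrow> x \<in> lattice_pts \<and> t \<in> lattice_pts"
  unfolding lattice_pts_def Basis_prod_def by (auto simp: ball_Un)

lemma lattice_vec: "(t :: real ^ 'c) \<in> lattice_pts \<longleftrightarrow> (\<forall>j. t $ j \<in> \<int>)"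
  unfolding lattice_pts_def Basis_vec_def by (auto simp: inner_axis)

lemma lattice_axis: "(axis j 1 :: real ^ 'c) \<in> lattice_pts"
  unfolding lattice_vec axis_def by simp

lemma axis_eq_iff [simp]: "(axis i 1 :: real ^ 'c) = axis j 1 \<longleftrightarrow> i = j"
  by (auto simp: axis_eq_axis)

lemma primitive_axis: "primitive (0 :: 'a::euclidean_space, axis j 1 :: real ^ 'c)"
  by (rule primitive_of_inner[of _ "(0, - axis j 1)"])
    (auto simp: lattice_Pair lattice_axis lattice_uminus inner_axis_axis)

text \<open>If some coordinate is governed by an inequality, the cone contains the corresponding
  fibre direction and can only be that ray. Otherwise it is the graph of the local data over a cone
  of the base, which must itself be a ray.\<close>

lemma rays_tot_dual_fan:
  fixes \<Sigma> :: "'a::euclidean_space fan" and D :: "'c::finite \<Rightarrow> 'a \<Rightarrow> int"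
  assumes zero: "\<And>\<sigma>. \<sigma> \<in> \<Sigma> \<Longrightarrow> 0 \<in> \<sigma>" and x: "x \<in> rays (tot_dual_fan \<Sigma> D)"
  shows "(\<exists>j. x = (0, axis j 1)) \<or> (\<exists>u\<in>rays \<Sigma>. x = (u, \<chi> j. of_int (D j u)))"
proof -
  obtain u0 t0 where x_eq: "x = (u0, t0)" by force
  have prim: "primitive (u0, t0)" and "{r *\<^sub>R (u0, t0) | r. 0 \<le> r} \<in> tot_dual_fan \<Sigma> D"
    using x unfolding rays_def x_eq by auto
  then obtain \<sigma> J m where
    C: "{r *\<^sub>R (u0, t0) | r. 0 \<le> r} =
        {(u, t). u \<in> \<sigma> \<and> (\<forall>j\<in>J. t $ j \<ge> m j \<bullet> u) \<and> (\<forall>j\<in>-J. t $ j = m j \<bullet> u)}"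
    and \<sigma>: "\<sigma> \<in> \<Sigma>"
    and m: "\<forall>j. m j \<in> lattice_pts \<and> (\<forall>u\<in>rays \<Sigma> \<inter> \<sigma>. m j \<bullet> u = of_int (D j u))"
    unfolding tot_dual_fan_def by blast
  have "(u0, t0) = 1 *\<^sub>R (u0, t0)" by simp
  then have "(u0, t0) \<in> {r *\<^sub>R (u0, t0) | r. 0 \<le> r}"
    using zero_le_one by blast
  then have mem: "u0 \<in> \<sigma>" "\<forall>j\<in>-J. t0 $ j = m j \<bullet> u0" unfolding C by auto
  show ?thesis
  proof (cases "J = {}")
    case False
    then obtain j where "j \<in> J" by blast
    then have "(0, axis j 1) \<in> {r *\<^sub>R (u0, t0) | r. 0 \<le> r}"
      unfolding C using zero[OF \<sigma>] by (auto simp: axis_def)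
    then obtain r where r: "r \<ge> 0" "(0, axis j 1) = r *\<^sub>R (u0, t0)" by blast
    have "primitive (r *\<^sub>R (u0, t0))" using primitive_axis unfolding r(2)[symmetric] .
    then have "r = 1" using primitive_multiple[OF prim _ r(1)] by blast
    then show ?thesis using r(2) x_eq by auto
  next
    case True
    have t0: "t0 = (\<chi> j. m j \<bullet> u0)" using mem(2) True by (simp add: vec_eq_iff)
    have "u0 \<noteq> 0"
    proof
      assume "u0 = 0"
      then have "(u0, t0) = 0" using t0 by (simp add: vec_eq_iff zero_prod_def)
      then show False using prim unfolding primitive_def by blast
    qed
    moreover have "u0 \<in> lattice_pts"
      using prim unfolding primitive_def lattice_Pair by blast
    moreover have "r *\<^sub>R u0 \<notin> lattice_pts" if r: "0 < r" "r < 1" for r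
    proof
      assume lat: "r *\<^sub>R u0 \<in> lattice_pts"
      \<comment> \<open>Integral local data transfer primitivity from the graph to the base.\<close>
      have "m j \<bullet> (r *\<^sub>R u0) \<in> \<int>" for j
        using m lat lattice_inner by blast
      then have "r *\<^sub>R t0 \<in> lattice_pts"
        unfolding lattice_vec t0 by simp
      then have "r *\<^sub>R (u0, t0) \<in> lattice_pts"
        using lat by (simp add: lattice_Pair)
      then show False using prim r unfolding primitive_def by blast
    qed
    ultimately have "primitive u0" unfolding primitive_def by blast
    moreover have "{r *\<^sub>R u0 | r. 0 \<le> r} = \<sigma>"
    proof (intro equalityI subsetI)
      fix u assume "u \<in> {r *\<^sub>R u0 | r. 0 \<le> r}"
      then obtain r where r: "r \<ge> 0" "u = r *\<^sub>R u0" by blast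
      then have "r *\<^sub>R (u0, t0) \<in> {r *\<^sub>R (u0, t0) | r. 0 \<le> r}" by blast
      then show "u \<in> \<sigma>" unfolding C using r by auto
    next
      fix u assume "u \<in> \<sigma>"
      then have "(u, \<chi> j. m j \<bullet> u) \<in> {r *\<^sub>R (u0, t0) | r. 0 \<le> r}"
        unfolding C using True by auto
      then show "u \<in> {r *\<^sub>R u0 | r. 0 \<le> r}" by auto
    qed
    ultimately have "u0 \<in> rays \<Sigma>" unfolding rays_def using \<sigma> by blast
    moreover from this have "t0 = (\<chi> j. of_int (D j u0))"
      using m mem(1) unfolding t0 by (simp add: vec_eq_iff)
    ultimately show ?thesis using x_eq by blast
  qed
qed

lemma zero_in_normal_fan: "\<sigma> \<in> normal_fan S \<Longrightarrow> 0 \<in> \<sigma>"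
  unfolding normal_fan_def normal_cone_def by auto

section \<open>Polyhedra of linear data\<close>

lemma data_polyhedron_translate:
  fixes A :: "'i \<Rightarrow> 'a::euclidean_space"
  assumes "\<And>s. s \<in> I \<Longrightarrow> \<beta> s = \<alpha> s + A s \<bullet> y"
  shows "data_polyhedron I A \<beta> = (+) (- y) ` data_polyhedron I A \<alpha>"
proof (intro equalityI subsetI)
  fix x assume "x \<in> data_polyhedron I A \<beta>"
  then have "y + x \<in> data_polyhedron I A \<alpha>"
    using assms unfolding data_polyhedron_def by (auto simp: inner_add_right algebra_simps)
  then have "- y + (y + x) \<in> (+) (- y) ` data_polyhedron I A \<alpha>" by blast
  then show "x \<in> (+) (- y) ` data_polyhedron I A \<alpha>" by simp
next
  fix x assume "x \<in> (+) (- y) ` data_polyhedron I A \<alpha>"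
  then show "x \<in> data_polyhedron I A \<beta>"
    using assms unfolding data_polyhedron_def by (auto simp: inner_add_right inner_diff_right algebra_simps)
qed

lemma convex_data_polyhedron: "convex (data_polyhedron I A \<alpha>)"
proof -
  have "data_polyhedron I A \<alpha> = (\<Inter>s\<in>I. {\<xi>. A s \<bullet> \<xi> \<ge> - \<alpha> s})"
    unfolding data_polyhedron_def by force
  then show ?thesis by (simp add: convex_INT convex_halfspace_ge)
qed

text \<open>Isolates one index when a sum is minimised by varying only the variables of that
  index.\<close>

lemma sum_le_at:
  fixes F G :: "'c::finite \<Rightarrow> real"
  assumes "sum F UNIV \<le> sum G UNIV" "\<And>i. i \<noteq> j \<Longrightarrow> F i = G i"
  shows "F j \<le> G j"
proof -
  have "sum F (UNIV - {j}) = sum G (UNIV - {j})"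
    using assms(2) by (intro sum.cong) auto
  then show ?thesis
    using assms(1) by (simp add: sum.remove[of UNIV j])
qed

section \<open>The dual polyhedron and its normal fan\<close>

context nef
begin

text \<open>The polyhedron of the dual model for the lift with values in \<open>{0, \<i>}\<close>; the other lifts translate
  it. The constants are those of the monomials of the superpotential: only the monomials 0 of the
  summands, which have coefficient 1, get the constant 0.\<close>

definition dual_monomials :: "('a \<times> (real ^ 'c)) set" where
  "dual_monomials = {(\<mu>, axis j 1) | \<mu> j. \<mu> \<in> nabla (\<phi> j) \<inter> lattice_pts}"

definition dual_constants :: "'a \<times> (real ^ 'c) \<Rightarrow> real" where
  "dual_constants = (\<lambda>(\<mu>, t). if \<mu> = 0 then 0 else 1)"

definition dual_polyhedron :: "('a \<times> (real ^ 'c)) set" where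
  "dual_polyhedron = data_polyhedron dual_monomials (\<lambda>\<xi>. \<xi>) dual_constants"

text \<open>The monomial 0 of the \<open>j\<close>-th summand gives \<open>t j\<close> \<ge> 0. Once
  this holds, its constant may be raised to 1, so all monomials of the summand share the weight 1 +
  \<open>t j\<close> required by \<open>minkowski_decomp\<close>.\<close>

lemma mem_dual_polyhedron:
  "(\<nu>, t) \<in> dual_polyhedron \<longleftrightarrow>
     (\<forall>j. t $ j \<ge> 0 \<and> (\<forall>\<mu>\<in>nabla (\<phi> j) \<inter> lattice_pts. \<mu> \<bullet> \<nu> + (1 + t $ j) \<ge> 0))"
proof -
  have "(\<nu>, t) \<in> dual_polyhedron \<longleftrightarrow>
     (\<forall>j. \<forall>\<mu>\<in>nabla (\<phi> j) \<inter> lattice_pts. \<mu> \<bullet> \<nu> + t $ j + (if \<mu> = 0 then 0 else 1) \<ge> 0)"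
  proof -
    have "(\<forall>s\<in>dual_monomials. Q s) \<longleftrightarrow> (\<forall>j. \<forall>\<mu>\<in>nabla (\<phi> j) \<inter> lattice_pts. Q (\<mu>, axis j 1))" for Q
      unfolding dual_monomials_def by blast
    then show ?thesis
      unfolding dual_polyhedron_def data_polyhedron_def by (simp add: dual_constants_def inner_axis')
  qed
  also have "\<dots> \<longleftrightarrow>
     (\<forall>j. t $ j \<ge> 0 \<and> (\<forall>\<mu>\<in>nabla (\<phi> j) \<inter> lattice_pts. \<mu> \<bullet> \<nu> + (1 + t $ j) \<ge> 0))"
  proof (intro iff_allI iffI conjI ballI)
    fix j
    assume *: "\<forall>\<mu>\<in>nabla (\<phi> j) \<inter> lattice_pts. \<mu> \<bullet> \<nu> + t $ j + (if \<mu> = 0 then 0 else 1) \<ge> 0"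
    then show t: "t $ j \<ge> 0" using bspec[OF *, of 0] nabla_zero[of j] by simp
    fix \<mu> assume \<mu>: "\<mu> \<in> nabla (\<phi> j) \<inter> lattice_pts"
    show "\<mu> \<bullet> \<nu> + (1 + t $ j) \<ge> 0"
      using bspec[OF * \<mu>] t by (cases "\<mu> = 0") auto
  next
    fix j \<mu>
    assume *: "t $ j \<ge> 0 \<and> (\<forall>\<mu>\<in>nabla (\<phi> j) \<inter> lattice_pts. \<mu> \<bullet> \<nu> + (1 + t $ j) \<ge> 0)"
      and \<mu>: "\<mu> \<in> nabla (\<phi> j) \<inter> lattice_pts"
    show "\<mu> \<bullet> \<nu> + t $ j + (if \<mu> = 0 then 0 else 1) \<ge> 0"
      using bspec[OF conjunct2[OF *] \<mu>] * by (cases "\<mu> = 0") auto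
  qed
  finally show ?thesis .
qed

text \<open>For fixed \<open>t\<close> these are the two Minkowski lemmas with weights 1 +
  \<open>t j\<close>.\<close>

lemma dual_polyhedron_eq:
  "dual_polyhedron =
     {(\<Sum>j\<in>UNIV. (1 + t $ j) *\<^sub>R b j, t) | t b. \<forall>j. t $ j \<ge> 0 \<and> b j \<in> B j}"
proof (intro equalityI subsetI)
  fix x assume x: "x \<in> dual_polyhedron"
  obtain \<nu> t where x_eq: "x = (\<nu>, t)" by force
  note * = x[unfolded x_eq mem_dual_polyhedron]
  have "1 + t $ j > 0" for j using * by (simp add: add_pos_nonneg)
  moreover have "\<mu> \<bullet> \<nu> + (1 + t $ j) \<ge> 0" if "\<mu> \<in> nabla (\<phi> j)" "\<mu> \<in> lattice_pts" for j \<mu>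
    using * that by blast
  ultimately obtain b where "\<forall>j. b j \<in> B j" "\<nu> = (\<Sum>j\<in>UNIV. (1 + t $ j) *\<^sub>R b j)"
    by (rule minkowski_decomp)
  then show "x \<in> {(\<Sum>j\<in>UNIV. (1 + t $ j) *\<^sub>R b j, t) | t b. \<forall>j. t $ j \<ge> 0 \<and> b j \<in> B j}"
    unfolding x_eq using * by blast
next
  fix x assume "x \<in> {(\<Sum>j\<in>UNIV. (1 + t $ j) *\<^sub>R b j, t) | t b. \<forall>j. t $ j \<ge> 0 \<and> b j \<in> B j}"
  then obtain t b where tb: "\<forall>j. t $ j \<ge> 0 \<and> b j \<in> B j"
    "x = (\<Sum>j\<in>UNIV. (1 + t $ j) *\<^sub>R b j, t)" by blast
  show "x \<in> dual_polyhedron"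
    unfolding tb(2) mem_dual_polyhedron
    using tb(1) minkowski_nabla[of "\<lambda>j. 1 + t $ j" b] by simp
qed

lemma dual_inner:
  "(u, \<tau>) \<bullet> (\<Sum>j\<in>UNIV. (1 + t $ j) *\<^sub>R b j, t) =
     (\<Sum>j\<in>UNIV. (1 + t $ j) * (u \<bullet> b j) + \<tau> $ j * t $ (j :: 'c))"
  by (simp add: inner_sum_right inner_vec_def sum.distrib)

text \<open>On \<open>dual_polyhedron\<close> a linear form is a sum of terms in the independent pairs (b j, t j), so
  it can be minimised separately in each of them.\<close>

lemma normal_cone_dual_polyhedron:
  assumes b: "\<And>j. b j \<in> B j" and t: "\<And>j. t $ j \<ge> 0"
  shows "normal_cone dual_polyhedron {(\<Sum>j\<in>UNIV. (1 + t $ j) *\<^sub>R b j, t)} =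
    {(u, \<tau>). u \<in> normal_cone (mirror_polytope \<phi>) {\<Sum>j\<in>UNIV. b j} \<and>
      (\<forall>j. \<tau> $ j \<ge> - (u \<bullet> b j) \<and> (t $ j > 0 \<longrightarrow> \<tau> $ j = - (u \<bullet> b j)))}" (is "?L = ?R")
proof (intro equalityI subsetI)
  fix x assume x: "x \<in> ?L"
  obtain u \<tau> where x_eq: "x = (u, \<tau>)" by force
  have min: "(\<Sum>j\<in>UNIV. (1 + t $ j) * (u \<bullet> b j) + \<tau> $ j * t $ j) \<le>
      (\<Sum>j\<in>UNIV. (1 + t' $ j) * (u \<bullet> b' j) + \<tau> $ j * t' $ j)"
    if "\<forall>j. t' $ j \<ge> 0 \<and> b' j \<in> B j" for t' b'
  proof -
    have "(\<Sum>j\<in>UNIV. (1 + t' $ j) *\<^sub>R b' j, t') \<in> dual_polyhedron"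
      unfolding dual_polyhedron_eq using that by blast
    then have "(u, \<tau>) \<bullet> (\<Sum>j\<in>UNIV. (1 + t $ j) *\<^sub>R b j, t) \<le>
        (u, \<tau>) \<bullet> (\<Sum>j\<in>UNIV. (1 + t' $ j) *\<^sub>R b' j, t')"
      using x unfolding x_eq normal_cone_def by blast
    then show ?thesis unfolding dual_inner .
  qed
  have min_t: "(1 + t $ j) * (u \<bullet> b j) + \<tau> $ j * t $ j \<le> (1 + s) * (u \<bullet> b j) + \<tau> $ j * s"
    if "s \<ge> 0" for j s
    using sum_le_at[OF min[of "\<chi> i. if i = j then s else t $ i" b], of j] that b t by simp
  have "u \<bullet> b j \<le> u \<bullet> b'" if "b' \<in> B j" for j b'
  proof -
    have "(1 + t $ j) * (u \<bullet> b j) \<le> (1 + t $ j) * (u \<bullet> b')"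
      using sum_le_at[OF min[of t "b(j := b')"], of j] that b t by simp
    then show ?thesis using t[of j] by (simp add: mult_le_cancel_left_pos add_pos_nonneg)
  qed
  then have "u \<in> normal_cone (mirror_polytope \<phi>) {\<Sum>j\<in>UNIV. b j}"
    unfolding normal_cone_mirror[OF b] by blast
  \<comment> \<open>Raising \<open>t j\<close> by 1 must not decrease the form.\<close>
  moreover have ge: "\<tau> $ j \<ge> - (u \<bullet> b j)" for j
    using min_t[of "t $ j + 1" j] t[of j] by (simp add: algebra_simps)
  moreover have "\<tau> $ j = - (u \<bullet> b j)" if "t $ j > 0" for j
  proof -
    \<comment> \<open>Lowering a positive \<open>t j\<close> to 0 must not decrease the form
      either.\<close>
    have "t $ j * (u \<bullet> b j + \<tau> $ j) \<le> 0"
      using min_t[of 0 j] by (simp add: algebra_simps)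
    then have "u \<bullet> b j + \<tau> $ j \<le> 0" using that by (simp add: mult_le_0_iff)
    then show ?thesis using ge[of j] by linarith
  qed
  ultimately show "x \<in> ?R" unfolding x_eq by blast
next
  fix x assume x: "x \<in> ?R"
  obtain u \<tau> where x_eq: "x = (u, \<tau>)" by force
  have u: "u \<bullet> b j \<le> u \<bullet> b'" if "b' \<in> B j" for j b'
    using x that unfolding x_eq using normal_cone_mirror[OF b] by blast
  have \<tau>: "\<tau> $ j \<ge> - (u \<bullet> b j)" "t $ j > 0 \<Longrightarrow> \<tau> $ j = - (u \<bullet> b j)" for j
    using x unfolding x_eq by auto
  have "(u, \<tau>) \<bullet> (\<Sum>j\<in>UNIV. (1 + t $ j) *\<^sub>R b j, t) \<le>
      (u, \<tau>) \<bullet> (\<Sum>j\<in>UNIV. (1 + t' $ j) *\<^sub>R b' j, t')"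
    if tb': "\<forall>j. t' $ j \<ge> 0 \<and> b' j \<in> B j" for t' b'
    unfolding dual_inner
  proof (rule sum_mono)
    fix j
    \<comment> \<open>Complementary slackness: the \<open>j\<close>-th term reduces to its value at
      \<open>t j\<close> = 0.\<close>
    have "t $ j * (u \<bullet> b j + \<tau> $ j) = 0"
      using \<tau>(2)[of j] t[of j] by (cases "t $ j = 0") auto
    then have "(1 + t $ j) * (u \<bullet> b j) + \<tau> $ j * t $ j = u \<bullet> b j"
      by (simp add: algebra_simps)
    also have "\<dots> \<le> u \<bullet> b j + t' $ j * (u \<bullet> b j + \<tau> $ j)"
      using tb' \<tau>(1)[of j] by simp
    also have "\<dots> = (1 + t' $ j) * (u \<bullet> b j) + \<tau> $ j * t' $ j"
      by (simp add: algebra_simps)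
    also have "\<dots> \<le> (1 + t' $ j) * (u \<bullet> b' j) + \<tau> $ j * t' $ j"
      using tb' u by (intro add_right_mono mult_left_mono) auto
    finally show "(1 + t $ j) * (u \<bullet> b j) + \<tau> $ j * t $ j
        \<le> (1 + t' $ j) * (u \<bullet> b' j) + \<tau> $ j * t' $ j" .
  qed
  then show "x \<in> ?L"
    unfolding x_eq normal_cone_def dual_polyhedron_eq by auto
qed

lemma convex_dual_polyhedron: "convex dual_polyhedron"
  unfolding dual_polyhedron_def by (rule convex_data_polyhedron)

lemma mirror_fan_eq:
  "mirror_fan \<phi> = {normal_cone (mirror_polytope \<phi>) {\<Sum>j\<in>UNIV. b j} | b. \<forall>j. b j \<in> B j}"
proof -
  have "convex (mirror_polytope \<phi>)"
    using mirror_polytope_lattice lattice_polytopeD(3) by blast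
  then show ?thesis
    unfolding mirror_fan_def by (subst normal_fan_pointwise) (auto simp: mirror_polytope_eq)
qed

text \<open>The index set \<open>J\<close> of a cone of the total space corresponds to the vanishing
  coordinates of \<open>t\<close>, and the base cone to the sum of the \<open>b j\<close>.\<close>

lemma normal_fan_dual_polyhedron:
  "normal_fan dual_polyhedron = tot_dual_fan (mirror_fan \<phi>) (mirror_divisor \<phi>)"
proof (intro equalityI subsetI)
  fix C assume "C \<in> normal_fan dual_polyhedron"
  then obtain x where "x \<in> dual_polyhedron" "C = normal_cone dual_polyhedron {x}"
    unfolding normal_fan_pointwise[OF convex_dual_polyhedron] by blast
  then obtain t b where tb: "\<And>j. t $ j \<ge> 0" "\<And>j. b j \<in> B j"
    and C: "C = normal_cone dual_polyhedron {(\<Sum>j\<in>UNIV. (1 + t $ j) *\<^sub>R b j, t)}"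
    unfolding dual_polyhedron_eq by blast
  define \<sigma> where "\<sigma> = normal_cone (mirror_polytope \<phi>) {\<Sum>j\<in>UNIV. b j}"
  have "\<forall>j. \<exists>m. m \<in> lattice_pts \<and> (\<forall>u\<in>\<sigma>. m \<bullet> u = - (u \<bullet> b j))"
    unfolding \<sigma>_def using cone_cartier_exists[OF tb(2)] by metis
  then obtain m where m: "\<And>j. m j \<in> lattice_pts" "\<And>j u. u \<in> \<sigma> \<Longrightarrow> m j \<bullet> u = - (u \<bullet> b j)"
    by metis
  have "\<sigma> \<in> mirror_fan \<phi>" unfolding mirror_fan_eq \<sigma>_def using tb(2) by blast
  moreover have "m j \<bullet> w = of_int (mirror_divisor \<phi> j w)" if "w \<in> rays (mirror_fan \<phi>) \<inter> \<sigma>" for j w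
    using cone_ray_value[of b w j, OF tb(2)] m(2)[of w j] that unfolding \<sigma>_def by auto
  moreover have "C = {(u, \<tau>). u \<in> \<sigma> \<and> (\<forall>j\<in>{j. t $ j = 0}. \<tau> $ j \<ge> m j \<bullet> u) \<and>
      (\<forall>j\<in>-{j. t $ j = 0}. \<tau> $ j = m j \<bullet> u)}"
  proof -
    have "t $ j = 0 \<longleftrightarrow> \<not> t $ j > 0" for j using tb(1)[of j] by auto
    then show ?thesis
      unfolding C normal_cone_dual_polyhedron[OF tb(2,1)] \<sigma>_def[symmetric] using m(2) by fastforce
  qed
  ultimately show "C \<in> tot_dual_fan (mirror_fan \<phi>) (mirror_divisor \<phi>)"
    unfolding tot_dual_fan_def using m(1) by blast
next
  fix C assume "C \<in> tot_dual_fan (mirror_fan \<phi>) (mirror_divisor \<phi>)"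
  then obtain \<sigma> J m where C: "C = {(u, t). u \<in> \<sigma> \<and> (\<forall>j\<in>J. t $ j \<ge> m j \<bullet> u) \<and>
      (\<forall>j\<in>-J. t $ j = m j \<bullet> u)}" and "\<sigma> \<in> mirror_fan \<phi>"
    and m: "\<And>j u. u \<in> rays (mirror_fan \<phi>) \<inter> \<sigma> \<Longrightarrow> m j \<bullet> u = of_int (mirror_divisor \<phi> j u)"
    unfolding tot_dual_fan_def by blast
  then obtain b where b: "\<And>j. b j \<in> B j"
    and \<sigma>: "\<sigma> = normal_cone (mirror_polytope \<phi>) {\<Sum>j\<in>UNIV. b j}"
    unfolding mirror_fan_eq by blast
  have mb: "m j \<bullet> u = - (u \<bullet> b j)" if "u \<in> \<sigma>" for j u
    using cone_cartier_data[OF b, of "m j" j u] m[of _ j] that unfolding \<sigma> by blast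
  \<comment> \<open>Any point with exactly the coordinates in \<open>J\<close> equal to zero
    realises the cone.\<close>
  define t :: "real ^ 'c" where "t = (\<chi> j. if j \<in> J then 0 else 1)"
  have t: "t $ j \<ge> 0" for j unfolding t_def by simp
  have "C = normal_cone dual_polyhedron {(\<Sum>j\<in>UNIV. (1 + t $ j) *\<^sub>R b j, t)}"
    unfolding normal_cone_dual_polyhedron[OF b t] \<sigma>[symmetric] C
    using mb by (fastforce simp: t_def)
  moreover have "(\<Sum>j\<in>UNIV. (1 + t $ j) *\<^sub>R b j, t) \<in> dual_polyhedron"
    unfolding dual_polyhedron_eq using b t by blast
  ultimately show "C \<in> normal_fan dual_polyhedron"
    unfolding normal_fan_pointwise[OF convex_dual_polyhedron] by blast
qed

text \<open>Over the mirror polytope every nonnegative \<open>t\<close> is allowed, which gives an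
  open product set.\<close>

lemma interior_dual_polyhedron: "interior dual_polyhedron \<noteq> {}"
proof -
  define U :: "(real ^ 'c) set" where "U = (\<Inter>j. {t. t $ j > 0})"
  have "interior (mirror_polytope \<phi>) \<times> U \<subseteq> dual_polyhedron"
  proof clarify
    fix \<nu> t assume "\<nu> \<in> interior (mirror_polytope \<phi>)" and t: "t \<in> U"
    then have "\<nu> \<in> mirror_polytope \<phi>" using interior_subset by blast
    then have "\<forall>j. \<forall>\<mu>\<in>nabla (\<phi> j). \<mu> \<bullet> \<nu> + 1 \<ge> 0" unfolding mirror_polytope_halfspaces by blast
    moreover have "\<forall>j. t $ j \<ge> 0" using t unfolding U_def by (auto intro: less_imp_le)
    ultimately show "(\<nu>, t) \<in> dual_polyhedron"
      unfolding mem_dual_polyhedron by (fastforce simp: add.assoc[symmetric])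
  qed
  moreover have "open U"
    unfolding U_def by (intro open_INT) (auto intro!: open_Collect_less continuous_intros)
  ultimately have "interior (mirror_polytope \<phi>) \<times> U \<subseteq> interior dual_polyhedron"
    by (intro interior_maximal open_Times open_interior)
  moreover have "(0, \<chi> j. 1) \<in> interior (mirror_polytope \<phi>) \<times> U"
    using mirror_reflexive unfolding reflexive_def U_def by simp
  ultimately show ?thesis by blast
qed

text \<open>Provides the irredundancy condition of \<open>dual_LG\<close>. The inequality of a fibre
  ray has constant 0 and is tight at the origin; that of a ray over the mirror fan has constant 1
  and is tight at an exposing point of the mirror polytope with \<open>t\<close> = 0.\<close>

lemma dual_rays_attained:
  assumes "s \<in> rays (tot_dual_fan (mirror_fan \<phi>) (mirror_divisor \<phi>))"
  shows "s \<in> dual_monomials \<and> (\<exists>x\<in>dual_polyhedron. s \<bullet> x + dual_constants s = 0)"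
proof -
  have "(\<exists>j. s = (0, axis j 1)) \<or>
      (\<exists>u\<in>rays (mirror_fan \<phi>). s = (u, \<chi> j. of_int (mirror_divisor \<phi> j u)))"
    using rays_tot_dual_fan[OF _ assms] zero_in_normal_fan unfolding mirror_fan_def by blast
  then show ?thesis
  proof
    assume "\<exists>j. s = (0, axis j 1)"
    then obtain j where s: "s = (0, axis j 1)" by blast
    have "(0, 0) \<in> dual_polyhedron" unfolding mem_dual_polyhedron by simp
    then show ?thesis
      unfolding s dual_monomials_def dual_constants_def using nabla_zero[of j]
      by (auto intro!: bexI[of _ "(0, 0)"])
  next
    assume "\<exists>u\<in>rays (mirror_fan \<phi>). s = (u, \<chi> j. of_int (mirror_divisor \<phi> j u))"
    then obtain u where u: "u \<in> rays (mirror_fan \<phi>)" "s = (u, \<chi> j. of_int (mirror_divisor \<phi> j u))"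
      by blast
    obtain i where i: "u \<in> nabla (\<phi> i)" "u \<in> lattice_pts" "u \<noteq> 0"
      "\<forall>j. mirror_divisor \<phi> j u = (if j = i then 1 else 0)"
      by (rule mirror_ray_nabla[OF u(1)])
    have s: "s = (u, axis i 1)" unfolding u(2) axis_def using i(4) by (simp add: vec_eq_iff)
    obtain b where b: "\<forall>j. b j \<in> B j" "u \<bullet> (\<Sum>j\<in>UNIV. b j) = -1"
      by (rule mirror_ray_exposed[OF u(1)])
    have "(\<Sum>j\<in>UNIV. b j) \<in> mirror_polytope \<phi>"
      unfolding mirror_polytope_eq using b(1) by blast
    then have "(\<Sum>j\<in>UNIV. b j, 0) \<in> dual_polyhedron"
      unfolding mem_dual_polyhedron mirror_polytope_halfspaces by auto
    then show ?thesis
      unfolding s dual_monomials_def dual_constants_def using i(1,2,3) b(2)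
      by (auto intro!: bexI[of _ "(\<Sum>j\<in>UNIV. b j, 0)"])
  qed
qed

text \<open>Here \<open>nabla_B\<close> is read from the mirror side: the monomials of the dual
  superpotential are sections of the mirror divisors.\<close>

lemma generator_in_div_polytope:
  assumes "u \<in> insert 0 (E j)"
  shows "u \<in> div_polytope (mirror_fan \<phi>) (mirror_divisor \<phi> j) \<inter> lattice_pts"
proof -
  have "u \<in> B j" using assms E_subset_B zero_in_B by blast
  have "u \<bullet> w + of_int (mirror_divisor \<phi> j w) \<ge> 0" if w: "w \<in> rays (mirror_fan \<phi>)" for w
  proof -
    obtain i where i: "w \<in> nabla (\<phi> i)" "\<forall>j. mirror_divisor \<phi> j w = (if j = i then 1 else 0)"
      by (rule mirror_ray_nabla[OF w]) blast
    show ?thesis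
      using nabla_B[OF i(1) \<open>u \<in> B j\<close>] unfolding i(2)[rule_format] by (auto simp: inner_commute split: if_splits)
  qed
  moreover have "u \<in> lattice_pts" using assms E_lattice lattice_zero by blast
  ultimately show ?thesis unfolding div_polytope_def by blast
qed

end

section \<open>The dual of the Batyrev--Borisov model\<close>

text \<open>The coefficient exp(-2 pi) has normalised logarithm \<i>, which produces exactly the
  constant 1.\<close>

lemma Im_Ln_2pi_i:
  "Im (Ln 1 / (2 * of_real pi * \<i>)) = 0"
  "Im (Ln (of_real (exp (- 2 * pi))) / (2 * of_real pi * \<i>)) = 1"
proof -
  have "Ln (of_real (exp (- 2 * pi))) = of_real (- 2 * pi)"
    by (subst Ln_of_real) auto
  then show "Im (Ln (of_real (exp (- 2 * pi))) / (2 * of_real pi * \<i>)) = 1"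
    by (simp add: field_simps)
qed simp

lemma coker_CZ_refl: "l \<in> coker_CZ I A l"
  unfolding coker_CZ_def by (intro CollectI exI[of _ 0]) (simp flip: zero_complex.code)

theorem theorem9p13:
  fixes P :: "(real ^ 'n) set"
    and D :: "'c::finite \<Rightarrow> real ^ 'n \<Rightarrow> int"
    and \<phi> :: "'c \<Rightarrow> real ^ 'n \<Rightarrow> real"
    and K :: "(real ^ 'n \<Rightarrow> complex) set"
    and Y :: "(real ^ 'n) fan"
    and X :: "((real ^ 'n) \<times> (real ^ 'c)) fan"
    and W :: "(real ^ 'n) \<times> (real ^ 'c) \<Rightarrow> complex"
  assumes "reflexive P"
    and "Y = normal_fan P"
    and "cy_nef_sub_partition Y D"
    and "nef_partition P (\<lambda>j. divisor_gens Y (D j)) \<phi>"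
    and "X = tot_dual_fan Y D"
    and "W = section_fun (w_BB Y D)"
    and "K \<in> chow_CZ Y"
  shows "(\<exists>X' W' K'. dual_LG X W (chow_pullback Y D K) X' W' K') \<and>
         (\<forall>X' W' K'. dual_LG X W (chow_pullback Y D K) X' W' K' \<longrightarrow>
            X' = tot_dual_fan (mirror_fan \<phi>) (mirror_divisor \<phi>) \<and>
            (\<exists>s. global_section (mirror_fan \<phi>) (mirror_divisor \<phi>) s \<and> W' = section_fun s))"
proof -
  interpret nef P "\<lambda>j. divisor_gens Y (D j)" \<phi>
    using assms(1,4) by unfold_locales
  have rays_Y: "rays Y = verts (polar P)"
    unfolding assms(2) by (rule rays_normal_fan[OF assms(1)])
  have D: "of_int (D j u) = \<phi> j u" if u: "u \<in> rays Y" for j u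
  proof (cases "D j u = 0")
    case False
    then have "u \<in> divisor_gens Y (D j)" using u unfolding divisor_gens_def by blast
    then have "\<phi> j u = 1" using \<phi>_E by auto
    moreover have "D j u = 1"
    proof -
      have nonneg: "D i u \<ge> 0" for i
        using assms(3) u unfolding cy_nef_sub_partition_def by blast
      \<comment> \<open>The anticanonical bound and effectivity force a nonzero multiplicity to be
        1.\<close>
      have "(\<Sum>i\<in>UNIV. D i u) \<le> 1"
        using assms(3) u unfolding cy_nef_sub_partition_def anticanonical_def by fastforce
      moreover have "D j u \<le> (\<Sum>i\<in>UNIV. D i u)"
        by (rule member_le_sum) (use nonneg in auto)
      ultimately show ?thesis using False nonneg[of j] by linarith
    qed
    ultimately show ?thesis by simp
  next
    case True
    obtain i where i: "u \<in> divisor_gens Y (D i)"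
      using u E_Union unfolding rays_Y by blast
    then have "j \<noteq> i" using True unfolding divisor_gens_def by auto
    then show ?thesis using True \<phi>_E[OF i, of j] by simp
  qed
  have div_nabla: "div_polytope Y (D j) = nabla (\<phi> j)" for j
    unfolding div_polytope_def nabla_eq rays_Y[symmetric]
    using D by (force simp: inner_commute)

  have W_axis: "W (m, axis j 1) = w_BB Y D j m" for m j
    unfolding assms(6) section_fun_def by (simp add: sum.delta)
  have W_nonaxis: "W (m, t) = 0" if "\<And>j. t \<noteq> axis j 1" for m t
    unfolding assms(6) section_fun_def using that by simp
  have mon: "monomials W = dual_monomials"
  proof -
    have "m \<in> nabla (\<phi> j) \<inter> lattice_pts \<longleftrightarrow> W (m, axis j 1) \<noteq> 0" for j m
      unfolding W_axis w_BB_def div_nabla by auto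
    then have "dual_monomials = {(m, axis j 1) | m j. W (m, axis j 1) \<noteq> 0}"
      unfolding dual_monomials_def by simp
    also have "\<dots> = monomials W"
    proof (intro equalityI subsetI)
      fix x assume x: "x \<in> monomials W"
      obtain m t where "x = (m, t)" by force
      then show "x \<in> {(m, axis j 1) | m j. W (m, axis j 1) \<noteq> 0}"
        using x W_nonaxis[of t m] unfolding monomials_def by blast
    qed (auto simp: monomials_def)
    finally show ?thesis by simp
  qed
  have const: "Im (Ln (W s) / (2 * of_real pi * \<i>)) = dual_constants s" if s: "s \<in> monomials W" for s
  proof -
    obtain m j where mj: "s = (m, axis j 1)" "m \<in> nabla (\<phi> j) \<inter> lattice_pts"
      using s unfolding mon dual_monomials_def by blast
    then have "W s = (if m = 0 then 1 else of_real (exp (- 2 * pi)))"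
      unfolding mj(1) W_axis w_BB_def div_nabla by simp
    then show ?thesis
      unfolding mj(1) dual_constants_def using Im_Ln_2pi_i by (cases "m = 0") simp_all
  qed
  have poly: "\<exists>y. data_polyhedron (monomials W) (\<lambda>\<xi>. \<xi>) (\<lambda>\<xi>. Im (l \<xi>)) = (+) (- y) ` dual_polyhedron"
    if l: "l \<in> log_class W" for l
  proof -
    obtain x y where xy: "\<forall>s\<in>monomials W.
        l s - Ln (W s) / (2 * of_real pi * \<i>) - Complex (s \<bullet> x) (s \<bullet> y) \<in> \<int>"
      using l unfolding log_class_def coker_CZ_def by blast
    \<comment> \<open>Integers are real, so the imaginary part changes only by the element of the
      complexified lattice, that is, by a translation.\<close>
    have "Im (l s) = dual_constants s + s \<bullet> y" if s: "s \<in> monomials W" for s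
    proof -
      obtain k where "l s - Ln (W s) / (2 * of_real pi * \<i>) - Complex (s \<bullet> x) (s \<bullet> y) = of_int k"
        using xy s by (meson Ints_cases)
      then have "Im (l s - Ln (W s) / (2 * of_real pi * \<i>) - Complex (s \<bullet> x) (s \<bullet> y)) = 0"
        by simp
      then show ?thesis using const[OF s] by simp
    qed
    then show ?thesis
      unfolding dual_polyhedron_def mon[symmetric] by (intro exI data_polyhedron_translate)
  qed
  have fan: "normal_fan (data_polyhedron (monomials W) (\<lambda>\<xi>. \<xi>) (\<lambda>\<xi>. Im (l \<xi>))) =
      tot_dual_fan (mirror_fan \<phi>) (mirror_divisor \<phi>)" if "l \<in> log_class W" for l
    using poly[OF that] normal_fan_translate[OF convex_dual_polyhedron] normal_fan_dual_polyhedron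
    by metis

  have rays_X: "\<exists>u j. x = (u, axis j 1) \<and> u \<in> insert 0 (divisor_gens Y (D j))"
    if x: "x \<in> rays X" for x
  proof -
    have "(\<exists>j. x = (0, axis j 1)) \<or> (\<exists>u\<in>rays Y. x = (u, \<chi> j. of_int (D j u)))"
      using rays_tot_dual_fan[of Y x D] zero_in_normal_fan x unfolding assms(2,5) by blast
    then show ?thesis
    proof
      assume "\<exists>u\<in>rays Y. x = (u, \<chi> j. of_int (D j u))"
      then obtain u where u: "u \<in> rays Y" "x = (u, \<chi> j. of_int (D j u))" by blast
      obtain i where i: "u \<in> divisor_gens Y (D i)"
        using u(1) E_Union unfolding rays_Y by blast
      \<comment> \<open>A ray generator of \<open>Y\<close> occurs in exactly one divisor, with
        multiplicity 1, so its fibre coordinates form a unit vector.\<close>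
      have "x = (u, axis i 1)"
        unfolding u(2) axis_def using D[OF u(1)] \<phi>_E[OF i] by (simp add: vec_eq_iff)
      then show ?thesis using i by blast
    qed blast
  qed

  show ?thesis
  proof (intro conjI allI impI)
    \<comment> \<open>For existence the principal logarithms are taken as the lift; their polyhedron
      is \<open>dual_polyhedron\<close> without translation.\<close>
    define l where "l = (\<lambda>\<xi>. Ln (W \<xi>) / (2 * of_real pi * \<i>))"
    then have l: "l \<in> log_class W"
      unfolding log_class_def by (simp add: coker_CZ_refl)
    define Q where "Q = data_polyhedron (monomials W) (\<lambda>\<xi>. \<xi>) (\<lambda>\<xi>. Im (l \<xi>))"
    have Q: "Q = dual_polyhedron"
      unfolding Q_def dual_polyhedron_def mon[symmetric] data_polyhedron_def l_def using const by auto
    have "u \<in> monomials W \<and> (\<exists>x\<in>Q. u \<bullet> x + Im (l u) = 0)" if "u \<in> rays (normal_fan Q)" for u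
      using dual_rays_attained[of u] that const[of u]
      unfolding Q normal_fan_dual_polyhedron mon l_def by auto
    moreover have "interior Q \<noteq> {}" unfolding Q by (rule interior_dual_polyhedron)
    moreover have "\<exists>k. k \<in> chow_pullback Y D K"
    proof -
      obtain k where "k \<in> K" using assms(7) coker_CZ_refl unfolding chow_CZ_def by blast
      then show ?thesis unfolding chow_pullback_def using coker_CZ_refl by blast
    qed
    ultimately show "\<exists>X' W' K'. dual_LG X W (chow_pullback Y D K) X' W' K'"
      unfolding dual_LG_def Let_def using l unfolding Q_def by blast
  next
    fix X' W' K'
    assume dual: "dual_LG X W (chow_pullback Y D K) X' W' K'"
    then obtain l where l: "l \<in> log_class W"
      "X' = normal_fan (data_polyhedron (monomials W) (\<lambda>\<xi>. \<xi>) (\<lambda>\<xi>. Im (l \<xi>)))"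
      unfolding dual_LG_def Let_def by blast
    show "X' = tot_dual_fan (mirror_fan \<phi>) (mirror_divisor \<phi>)"
      unfolding l(2) by (rule fan[OF l(1)])
    obtain k where k: "W' = fun_of_data (rays X) (\<lambda>u. u) k"
      using dual unfolding dual_LG_def by blast
    \<comment> \<open>The lift \<open>k\<close> affects only coefficients, so the support is
      controlled by the rays for every class \<open>K\<close>.\<close>
    have W'0: "W' x = 0" if "x \<notin> rays X" for x
      using that unfolding k fun_of_data_def by (auto intro: sum.neutral)
    \<comment> \<open>The coefficients linear in the \<open>j\<close>-th fibre coordinate form the
      \<open>j\<close>-th component of the section.\<close>
    define s where "s j m = W' (m, axis j 1)" for j m
    have supp: "{m. s j m \<noteq> 0} \<subseteq> insert 0 (divisor_gens Y (D j))" for j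
    proof clarify
      fix m assume "s j m \<noteq> 0" "m \<notin> divisor_gens Y (D j)"
      then have "(m, axis j 1) \<in> rays X" using W'0 unfolding s_def by blast
      from rays_X[OF this] \<open>m \<notin> divisor_gens Y (D j)\<close> show "m = 0" by auto
    qed
    have "global_section (mirror_fan \<phi>) (mirror_divisor \<phi>) s"
      unfolding global_section_def
    proof
      fix j
      have "finite {m. s j m \<noteq> 0}"
        using finite_subset[OF supp] finite_E by simp
      then show "finite {m. s j m \<noteq> 0} \<and> {m. s j m \<noteq> 0} \<subseteq>
          div_polytope (mirror_fan \<phi>) (mirror_divisor \<phi> j) \<inter> lattice_pts"
        using supp[of j] generator_in_div_polytope[of _ j] by blast
    qed
    moreover have "W' = section_fun s"
    proof
      fix x :: "(real ^ 'n) \<times> (real ^ 'c)"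
      obtain m t where x: "x = (m, t)" by force
      show "W' x = section_fun s x"
      proof (cases "\<exists>j. t = axis j 1")
        case True
        then show ?thesis unfolding x section_fun_def s_def by (auto simp: sum.delta)
      next
        case False
        then have "W' x = 0" using W'0[of x] rays_X[of x] unfolding x by blast
        then show ?thesis using False unfolding x section_fun_def by auto
      qed
    qed
    ultimately show "\<exists>s. global_section (mirror_fan \<phi>) (mirror_divisor \<phi>) s \<and> W' = section_fun s"
      by blast
  qed
qed

end
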